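(* For any partition $\mu = (\mu_1, \mu_2, \ldots, \mu_n)$ of a positive integer $d$, \[ \mathrm{FSMap}(\mu) = z(\mu) \sum_{\lambda \vdash d} H^{\leq}(\mu; \lambda) \big|_{\hbar \to -\hbar} \, \mathrm{Map}(\lambda), \] where $\mathrm{Map}$ and $\mathrm{FSMap}$ are the weighted enumerations of (possibly disconnected) maps and of fully simple maps, and $H^{\leq}(\mu;\lambda)\big|_{\hbar \to -\hbar}$ is the generating series of weakly monotone Hurwitz numbers with $\hbar$ replaced by $-\hbar$ (the substitution is applied only to $H^{\leq}$).
   Context: **Maps.** A map is a finite graph (loops and multiple edges allowed) without isolated vertices, embedded into an oriented compact surface, such that the complement of the graph is a disjoint union of topological disks, called faces. Maps may be disconnected. An oriented edge is an edge with a choice of one of its two orientations; it is adjacent to the face on its left and incident to the vertex it points to. A map carries an ordered tuple $R=(r_1,\dots,r_n)$ of distinct oriented edges (roots), no two adjacent to the same face. Faces adjacent to roots are boundary faces (boundary face $i$ is the one adjacent to $r_i$); the other faces are internal faces. The degree of a face is the number of oriented edges adjacent to it. Two maps are equivalent if there is an orientation-preserving homeomorphism of the underlying surfaces carrying vertices, oriented edges and faces bijectively to vertices, oriented edges and faces, preserving adjacencies and the tuple of roots. Maps are counted up to equivalence. **Permutation model.** Equivalently, a map is encoded by $(\sigma_0,\sigma_1,\sigma_2;R)$, where $\sigma_0,\sigma_1,\sigma_2$ are permutations of a finite set $\mathbb{E}$ (the oriented edges), $\sigma_1$ is a fixed point free involution (swapping the two orientations of an edge), $\sigma_0\sigma_1\sigma_2=\mathrm{id}$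 (permutations multiplied right to left), and $R\in\mathbb{E}^n$ is a tuple no two entries of which lie in the same cycle of $\sigma_2$. Cycles of $\sigma_0$ are vertices, cycles of $\sigma_1$ are edges, cycles of $\sigma_2$ are faces (length = degree). Two such data are equivalent if there is a bijection $\phi:\mathbb{E}\to\widetilde{\mathbb{E}}$ sending $R$ to $\widetilde R$ (entry by entry) with $\widetilde\sigma_i=\phi\sigma_i\phi^{-1}$ for $i\in\{0,1,2\}$. **Fully simple.** A boundary edge is an oriented edge adjacent to a boundary face. A map is fully simple if each vertex is incident to at most one boundary edge. **Enumerations.** For positive integers $\mu_1,\dots,\mu_n$, $\mathrm{Map}(\mu_1,\dots,\mu_n)$ is the sum, over equivalence classes of maps $M$ with $n$ boundary faces such that boundary face $i$ has degree $\mu_i$ for $i=1,\dots,n$, of the weight \[ \frac{\hbar^{-\chi(M)}}{|\mathrm{Aut}\,M|}\,t_1^{f_1(M)}t_2^{f_2(M)}t_3^{f_3(M)}\cdots . \] Here $\chi(M)$ is the Euler characteristic of the underlying surface with the interiors of the boundary faces removed (number of vertices minus number of edges plus number of internal faces), $f_k(M)$ is the number of internal faces of degree $k$, and $|\mathrm{Aut}\,M|$ is the number of automorphisms, i.e. permutations of the oriented edges arising from an orientation-preserving self-homeomorphism of the surface that preserves the map and the tuple of roots (equivalently, self-equivalences of the data $(\sigma_0,\sigma_1,\sigma_2;R)$). $\mathrm{FSMap}(\mu_1,\dots,\mu_n)$ is the same sum restricted to fully simple maps. Each monomial in $t_1,t_2,\dots$ receives contributions from finitely many maps, so both are formal power series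 in $t_1,t_2,\ldots$ with coefficients in $\mathbb{Q}[\hbar,\hbar^{-1}]$; the identity can be read in formal power series in the $t_k$ with coefficients in the field of Laurent series $\mathbb{Q}((\hbar))$. **Weakly monotone Hurwitz numbers.** A sequence $\tau_1,\dots,\tau_k$ of transpositions in $\mathfrak{S}_d$ is weakly monotone if $\tau_i=(a_i\ b_i)$ with $a_i<b_i$ and $b_1\le b_2\le\dots\le b_k$. For partitions $\lambda,\mu$ of $d$ and $k\ge 0$, $H^{\le}_k(\lambda;\mu)$ is $\frac1{d!}$ times the number of tuples $(\rho_\lambda,\tau_1,\dots,\tau_k,\rho_\mu)$ of permutations in $\mathfrak{S}_d$ such that $\rho_\lambda$ has cycle type $\lambda$, $\rho_\mu$ has cycle type $\mu$, $\tau_1,\dots,\tau_k$ is a weakly monotone sequence of transpositions, and $\rho_\lambda\tau_1\cdots\tau_k\rho_\mu=\mathrm{id}$. Set $H^{\le}(\lambda;\mu)=\sum_{k\ge0}H^{\le}_k(\lambda;\mu)\,\hbar^k$ (a formal power series in $\hbar$). **Notation.** $\lambda\vdash d$ means $\lambda$ is a partition of $d$; $z(\mu)=\prod_{i=1}^{\ell(\mu)}\mu_i\cdot\prod_{j\ge1}m_j(\mu)!$, where $\ell(\mu)$ is the number of parts and $m_j(\mu)$ is the number of parts equal to $j$. *)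

theory Defs
  imports
    "HOL-Combinatorics.Combinatorics"
    "HOL-Library.Multiset"
    "HOL-Library.Poly_Mapping"
    "HOL-Computational_Algebra.Formal_Laurent_Series"
begin

section \<open>Rooted maps in the permutation model\<close>

text \<open>
  Permutations are functions that are the identity outside the finite carrier; they are
  multiplied right to left, i.e. by function composition. An oriented edge lies in the
  cycle of \<open>sigma0\<close> given by the vertex it points to, and in the cycle of \<open>sigma2\<close> given
  by the face on its left. Since \<open>orbit f x\<close> consists of the iterates \<open>(f ^^ n) x\<close> with
  \<open>n > 0\<close>, it is, for a permutation of a finite set, the support of the cycle through
  \<open>x\<close>, including the case of a fixed point (where it is \<open>{x}\<close>).
\<close>

record 'e map_data =
  oedges :: "'e set"
  sigma0 :: "'e \<Rightarrow> 'e"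
  sigma1 :: "'e \<Rightarrow> 'e"
  sigma2 :: "'e \<Rightarrow> 'e"
  roots :: "'e list"

definition cycles_on :: "('a \<Rightarrow> 'a) \<Rightarrow> 'a set \<Rightarrow> 'a set set" where
  "cycles_on p S = orbit p ` S"

definition is_map :: "'e map_data \<Rightarrow> bool" where
  "is_map M \<longleftrightarrow>
     finite (oedges M) \<and>
     sigma0 M permutes oedges M \<and>
     sigma1 M permutes oedges M \<and>
     sigma2 M permutes oedges M \<and>
     (\<forall>e\<in>oedges M. sigma1 M e \<noteq> e \<and> sigma1 M (sigma1 M e) = e) \<and>
     sigma0 M \<circ> sigma1 M \<circ> sigma2 M = id \<and>
     set (roots M) \<subseteq> oedges M \<and>
     distinct (map (orbit (sigma2 M)) (roots M))"

definition vertices :: "'e map_data \<Rightarrow> 'e set set" where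
  "vertices M = cycles_on (sigma0 M) (oedges M)"

definition edges :: "'e map_data \<Rightarrow> 'e set set" where
  "edges M = cycles_on (sigma1 M) (oedges M)"

definition faces :: "'e map_data \<Rightarrow> 'e set set" where
  "faces M = cycles_on (sigma2 M) (oedges M)"

definition boundary_faces :: "'e map_data \<Rightarrow> 'e set list" where
  "boundary_faces M = map (orbit (sigma2 M)) (roots M)"

definition internal_faces :: "'e map_data \<Rightarrow> 'e set set" where
  "internal_faces M = faces M - set (boundary_faces M)"

definition boundary_edges :: "'e map_data \<Rightarrow> 'e set" where
  "boundary_edges M = \<Union> (set (boundary_faces M))"

definition fully_simple :: "'e map_data \<Rightarrow> bool" where
  "fully_simple M \<longleftrightarrow> (\<forall>v\<in>vertices M. card (v \<inter> boundary_edges M) \<le> 1)"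

definition euler_char :: "'e map_data \<Rightarrow> int" where
  "euler_char M = int (card (vertices M)) - int (card (edges M)) + int (card (internal_faces M))"

definition num_internal :: "'e map_data \<Rightarrow> nat \<Rightarrow> nat" where
  "num_internal M k = card {F \<in> internal_faces M. card F = k}"

definition map_iso :: "('e \<Rightarrow> 'f) \<Rightarrow> 'e map_data \<Rightarrow> 'f map_data \<Rightarrow> bool" where
  "map_iso \<phi> M N \<longleftrightarrow>
     bij_betw \<phi> (oedges M) (oedges N) \<and>
     (\<forall>e\<in>oedges M. sigma0 N (\<phi> e) = \<phi> (sigma0 M e)) \<and>
     (\<forall>e\<in>oedges M. sigma1 N (\<phi> e) = \<phi> (sigma1 M e)) \<and>
     (\<forall>e\<in>oedges M. sigma2 N (\<phi> e) = \<phi> (sigma2 M e)) \<and>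
     roots N = map \<phi> (roots M)"

definition automorphisms :: "'e map_data \<Rightarrow> ('e \<Rightarrow> 'e) set" where
  "automorphisms M = {\<phi>. \<phi> permutes oedges M \<and> map_iso \<phi> M M}"


section \<open>Enumeration of maps\<close>

text \<open>
  A formal power series in \<open>t\<^sub>1, t\<^sub>2, \<dots>\<close> over the field of Laurent series in \<open>\<hbar>\<close> is given
  by its coefficients: \<open>m :: nat \<Rightarrow>\<^sub>0 nat\<close> stands for the monomial in which \<open>t\<^sub>k\<close> has
  exponent \<open>lookup m k\<close>. (A monomial involving the spurious variable \<open>t\<^sub>0\<close> has coefficient
  0 in the series below, as every face has positive degree.)
\<close>

type_synonym t_series = "(nat \<Rightarrow>\<^sub>0 nat) \<Rightarrow> rat fls"

text \<open>
  Every map is equivalent to one whose oriented edges are natural numbers, so equivalence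
  classes of maps are taken within the type \<^typ>\<open>nat map_data\<close>.
\<close>

definition map_equiv :: "(nat map_data \<times> nat map_data) set" where
  "map_equiv = {(M, N). is_map M \<and> is_map N \<and> (\<exists>\<phi>. map_iso \<phi> M N)}"

lemma equiv_map_equiv: "equiv {M. is_map M} map_equiv"
proof (rule equivI)
  show "map_equiv \<subseteq> {M. is_map M} \<times> {M. is_map M}"
    by (auto simp: map_equiv_def)
  have "map_iso id M M" for M :: "nat map_data"
    by (simp add: map_iso_def)
  then show "refl_on {M. is_map M} map_equiv"
    by (auto simp: map_equiv_def intro!: refl_onI)
  have "\<exists>\<psi>. map_iso \<psi> N M" if M: "is_map M" and iso: "map_iso \<phi> M N"
    for M N :: "nat map_data" and \<phi>
  proof
    let ?\<psi> = "the_inv_into (oedges M) \<phi>"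
    have bij: "bij_betw \<phi> (oedges M) (oedges N)"
      using iso by (simp add: map_iso_def)
    then have inj: "inj_on \<phi> (oedges M)" and img: "\<phi> ` oedges M = oedges N"
      by (simp_all add: bij_betw_def)
    have inv: "?\<psi> (\<phi> e) = e" if "e \<in> oedges M" for e
      using the_inv_into_f_f[OF inj that] .
    have closed: "sigma0 M e \<in> oedges M" "sigma1 M e \<in> oedges M" "sigma2 M e \<in> oedges M"
      if "e \<in> oedges M" for e
      using M that by (auto simp: is_map_def permutes_in_image)
    have comm: "sigma0 N (\<phi> e) = \<phi> (sigma0 M e)" "sigma1 N (\<phi> e) = \<phi> (sigma1 M e)"
      "sigma2 N (\<phi> e) = \<phi> (sigma2 M e)" if "e \<in> oedges M" for e
      using iso that by (auto simp: map_iso_def)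
    have "map ?\<psi> (map \<phi> (roots M)) = roots M"
      using M by (auto simp: is_map_def inv intro!: map_idI)
    then show "map_iso ?\<psi> N M"
      using bij_betw_the_inv_into[OF bij] iso
      unfolding map_iso_def by (auto simp: img[symmetric] inv comm closed)
  qed
  then show "sym map_equiv"
    unfolding map_equiv_def by (intro symI) blast
  have "map_iso (\<psi> \<circ> \<phi>) L N" if "map_iso \<phi> L M" "map_iso \<psi> M N"
    for L M N :: "nat map_data" and \<phi> \<psi>
    using that unfolding map_iso_def by (auto intro: bij_betw_trans dest: bij_betwE)
  then show "trans map_equiv"
    unfolding map_equiv_def by (intro transI) blast
qed

definition maps_with :: "nat list \<Rightarrow> (nat \<Rightarrow>\<^sub>0 nat) \<Rightarrow> nat map_data set" where
  "maps_with \<mu> m = {M. is_map M \<and> map card (boundary_faces M) = \<mu> \<and>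
                       (\<forall>k. num_internal M k = Poly_Mapping.lookup m k)}"

definition map_weight :: "'e map_data \<Rightarrow> rat fls" where
  "map_weight M = fls_const (1 / of_nat (card (automorphisms M))) * fls_X powi (- euler_char M)"

text \<open>The weight depends only on the equivalence class, so any representative will do.\<close>

definition class_weight :: "nat map_data set \<Rightarrow> rat fls" where
  "class_weight C = map_weight (SOME M. M \<in> C)"

definition Map_gf :: "nat list \<Rightarrow> t_series" where
  "Map_gf \<mu> = (\<lambda>m. \<Sum>C \<in> maps_with \<mu> m // map_equiv. class_weight C)"

definition FSMap_gf :: "nat list \<Rightarrow> t_series" where
  "FSMap_gf \<mu> = (\<lambda>m. \<Sum>C \<in> {M \<in> maps_with \<mu> m. fully_simple M} // map_equiv. class_weight C)"


section \<open>Partitions and weakly monotone Hurwitz numbers\<close>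

definition partitions :: "nat \<Rightarrow> nat list set" where
  "partitions d = {xs. sorted_wrt (\<ge>) xs \<and> (\<forall>x\<in>set xs. x > 0) \<and> sum_list xs = d}"

definition z_partition :: "nat list \<Rightarrow> nat" where
  "z_partition \<mu> = prod_list \<mu> * (\<Prod>j\<in>set \<mu>. fact (count_list \<mu> j))"

definition cycle_type_on :: "('a \<Rightarrow> 'a) \<Rightarrow> 'a set \<Rightarrow> nat multiset" where
  "cycle_type_on p S = image_mset card (mset_set (cycles_on p S))"

definition weakly_monotone :: "nat \<Rightarrow> (nat \<Rightarrow> nat) list \<Rightarrow> bool" where
  "weakly_monotone d \<tau>s \<longleftrightarrow>
     (\<exists>ps. \<tau>s = map (\<lambda>(a, b). transpose a b) ps \<and>
            (\<forall>(a, b)\<in>set ps. 1 \<le> a \<and> a < b \<and> b \<le> d) \<and>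
            sorted (map snd ps))"

definition hurwitz_tuples ::
  "nat \<Rightarrow> nat \<Rightarrow> nat list \<Rightarrow> nat list \<Rightarrow> ((nat \<Rightarrow> nat) \<times> (nat \<Rightarrow> nat) list \<times> (nat \<Rightarrow> nat)) set" where
  "hurwitz_tuples d k \<mu> \<nu> = {(\<rho>, \<tau>s, \<rho>').
     \<rho> permutes {1..d} \<and> cycle_type_on \<rho> {1..d} = mset \<mu> \<and>
     \<rho>' permutes {1..d} \<and> cycle_type_on \<rho>' {1..d} = mset \<nu> \<and>
     length \<tau>s = k \<and> weakly_monotone d \<tau>s \<and>
     \<rho> \<circ> foldr (\<circ>) \<tau>s id \<circ> \<rho>' = id}"

definition monotone_hurwitz_num :: "nat \<Rightarrow> nat \<Rightarrow> nat list \<Rightarrow> nat list \<Rightarrow> rat" where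
  "monotone_hurwitz_num d k \<mu> \<nu> = of_nat (card (hurwitz_tuples d k \<mu> \<nu>)) / fact d"

definition monotone_hurwitz_gf :: "nat \<Rightarrow> nat list \<Rightarrow> nat list \<Rightarrow> rat fps" where
  "monotone_hurwitz_gf d \<mu> \<nu> = Abs_fps (\<lambda>k. monotone_hurwitz_num d k \<mu> \<nu>)"

end

theory Submission
  imports Defs
begin

text \<open>
  Cut a map along its boundary: number the \<open>d\<close> boundary edges by \<open>1, \<dots>, d\<close>, so that the face
  permutation is \<open>\<rho> \<circ> \<tau>\<close> with \<open>\<rho>\<close> a permutation of \<open>{1..d}\<close> of cycle type \<open>\<mu>\<close> and \<open>\<tau>\<close> a
  permutation of the other oriented edges. Keep \<open>\<tau>\<close> and the edge involution \<open>\<alpha>\<close> and let \<open>\<rho>\<close> vary: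
  passing from \<open>\<rho>\<close> to \<open>\<rho> \<circ> \<pi>\<close> only replaces the vertex permutation \<open>s\<close> by \<open>\<pi>\<inverse> \<circ> s\<close>. The map is
  fully simple precisely when the points \<open>1, \<dots>, d\<close> lie on different cycles of \<open>s\<close>, and, for fixed
  interior data, its weight is a constant times \<open>\<hbar>\<close> to the power minus the number of cycles of
  \<open>s\<close>. So the theorem comes down to an identity about a single permutation \<open>s\<close>: weighting each \<open>\<pi>\<close> by
  the series in \<open>-\<hbar>\<close> that counts its weakly monotone factorizations,
  \[ \sum_{\pi} g(\pi)\, \hbar^{-\mathrm{cyc}(\pi^{-1} s)} =
     \hbar^{-\mathrm{cyc}(s)} \, [\, 1, \dots, d \mbox{ lie on different cycles of } s \,]. \]

  The identity (lemma \<open>sum_monotone_gf_isolated_weight\<close>) is proved by treating the points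
  \<open>d, d-1, \<dots>, 1\<close> one at a time. Let \<open>F\<^sub>j(s)\<close> be \<open>\<hbar>\<close> to the power minus the number of cycles if each of
  the points \<open>j+1, \<dots>, d\<close> is the only point of \<open>{1..d}\<close> on its cycle, and \<open>0\<close> otherwise. Following the
  cycle of \<open>j\<close> until it returns to \<open>{1..d}\<close> finds the unique \<open>a \<le> j\<close> for which \<open>(a j) \<circ> s\<close> has \<open>j\<close>
  alone on its cycle; for \<open>a < j\<close> this splits a cycle, which a factor \<open>\<hbar>\<close> compensates. Hence
  \<open>F\<^sub>j(s) = F\<^sub>j\<^sub>-\<^sub>1(s) + \<hbar> \<Sum>\<^bsub>a<j\<^esub> F\<^sub>j\<^sub>-\<^sub>1((a j) \<circ> s)\<close> (lemma \<open>isolated_weight_Suc\<close>), which is the action of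
  \<open>1 + \<hbar> J\<^sub>j\<close> for the Jucys-Murphy element \<open>J\<^sub>j = (1 j) + \<dots> + (j-1 j)\<close>. Splitting off the last
  transposition of a weakly monotone factorization gives the matching recursion for \<open>g\<close>
  (lemma \<open>monotone_gf_Suc\<close>), which says that \<open>g\<close> is the product of the inverses of these elements.

  Two countings turn this into the stated identity. First, a rooted map has no freedom in the numbering
  of its boundary once \<open>\<rho>\<close> and one point on each cycle of \<open>\<rho>\<close> are prescribed, so the sum over classes
  with weight \<open>1 / |Aut|\<close> is the sum over maps with oriented edges \<open>{1..N}\<close> and the prescribed boundary,
  divided by \<open>(N - d)!\<close> (lemma \<open>sum_class_weight\<close>). This gives \<open>FSMap(\<mu>)\<close> as a sum over \<open>\<pi>\<close> for each single \<open>\<rho>\<close>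
  of type \<open>\<mu>\<close> (lemma \<open>FSMap_gf_eq_sum_Map_gf\<close>). Second, averaging over all \<open>\<rho>\<close> of type \<open>\<mu>\<close>, of
  which there are \<open>d! / z(\<mu>)\<close> (lemma \<open>card_permutations_of_cycle_type\<close>), produces the monotone Hurwitz
  numbers.
\<close>

section \<open>Cycles of a permutation multiplied by a transposition\<close>

lemma permutation_image_orbit:
  assumes "permutation p" shows "p ` orbit p x = orbit p x"
  using orbit_inverse[where f=p and g=p and g'=p and a=x] permutation_self_in_orbit[OF assms, of x]
  by (simp add: permutation_orbit_step[OF assms])

lemma orbit_subset_invariant:
  assumes "p ` Z \<subseteq> Z" "x \<in> Z" shows "orbit p x \<subseteq> Z"
proof
  fix y assume "y \<in> orbit p x"
  then show "y \<in> Z" by induct (use assms in auto)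
qed

lemma orbit_eq_of_mem:
  assumes "permutation p" "y \<in> orbit p x" shows "orbit p y = orbit p x"
  using orbit_cyclic_eq3[OF cyclic_on_orbit'[OF assms(1)] assms(2)] .

lemma finite_orbit_permutation:
  assumes "permutation p" shows "finite (orbit p x)"
  using finite_orbit permutation_self_in_orbit[OF assms] by metis

text \<open>
  A bijection maps an invariant set to itself, so it cannot trade the point \<open>j\<close> of a finite
  set \<open>Y\<close> for the point \<open>a\<close> when \<open>j\<close> lies in the invariant set and \<open>a\<close> does not.
\<close>

lemma no_exchange_across_invariant_set:
  assumes "inj f" "f ` Z = Z" "finite Y" "f ` Y = insert a (Y - {j})"
    and "j \<in> Y" "j \<in> Z" "a \<notin> Z"
  shows False
proof -
  have "f ` (Y \<inter> Z) = f ` Y \<inter> f ` Z" using assms(1) by (rule image_Int)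
  also have "\<dots> = (Y \<inter> Z) - {j}" using assms by auto
  finally have "card (Y \<inter> Z) = card ((Y \<inter> Z) - {j})"
    using assms(1) by (metis card_image inj_on_subset subset_UNIV)
  moreover have "card ((Y \<inter> Z) - {j}) < card (Y \<inter> Z)"
    using assms by (intro psubset_card_mono) auto
  ultimately show False by simp
qed

lemma transpose_image_exchange:
  assumes "j \<in> Y" "a \<notin> Y" shows "transpose a j ` Y = insert a (Y - {j})"
  using assms by (auto simp: transpose_def image_iff)

lemma transpose_image_idem:
  assumes "a \<in> Y \<longleftrightarrow> j \<in> Y" shows "transpose a j ` Y = Y"
  using assms by (metis transpose_image_eq)

text \<open>
  The cycle \<open>Y\<close> of \<open>x\<close> under \<open>(a j) \<circ> f\<close> satisfies \<open>f ` Y = (a j) ` Y\<close>. If \<open>Y\<close> contains exactly one of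
  \<open>a\<close> and \<open>j\<close>, then \<open>f\<close> trades that one for the other, which lies on a different cycle of \<open>f\<close>, and this
  is impossible. Otherwise \<open>Y\<close> is invariant under \<open>f\<close>, so it contains the cycle of \<open>x\<close> under \<open>f\<close>, hence
  one of \<open>a\<close> and \<open>j\<close>, hence both, and with them both cycles.
\<close>

lemma orbit_transpose_comp_merged:
  assumes f: "permutation f" and a: "a \<notin> orbit f j" and x: "x \<in> orbit f a \<union> orbit f j"
  shows "orbit (transpose a j \<circ> f) x = orbit f a \<union> orbit f j"
proof -
  let ?s = "transpose a j \<circ> f" and ?U = "orbit f a \<union> orbit f j"
  define Y where "Y = orbit ?s x"
  have s: "permutation ?s" using f by (simp add: permutation_compose permutation_swap_id)
  have inj: "inj f" using f by (simp add: permutation bij_is_inj)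
  have self: "y \<in> orbit f y" for y using permutation_self_in_orbit[OF f] .
  have j: "j \<notin> orbit f a" using a orbit_eq_of_mem[OF f] self by metis
  have imU: "f ` ?U = ?U" by (simp add: image_Un permutation_image_orbit[OF f])
  have "?s ` ?U = transpose a j ` f ` ?U" by (simp only: image_comp)
  also have "\<dots> = ?U" unfolding imU by (rule transpose_image_idem) (use self in auto)
  finally have sub: "Y \<subseteq> ?U" unfolding Y_def by (intro orbit_subset_invariant x) simp
  have finY: "finite Y" unfolding Y_def by (rule finite_orbit_permutation[OF s])
  have xY: "x \<in> Y" unfolding Y_def by (rule permutation_self_in_orbit[OF s])
  have "f ` Y = transpose a j ` ?s ` Y" by (auto simp: image_comp o_def)
  then have fY: "f ` Y = transpose a j ` Y" unfolding Y_def permutation_image_orbit[OF s] .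
  have closed: "orbit f y \<subseteq> Y" if "y \<in> Y" "f ` Y = Y" for y
    using orbit_subset_invariant[of f Y y] that by auto
  consider "a \<in> Y" "j \<in> Y" | "a \<notin> Y" "j \<notin> Y" | "a \<in> Y" "j \<notin> Y" | "a \<notin> Y" "j \<in> Y" by blast
  then have "?U \<subseteq> Y"
  proof cases
    case 1 then show ?thesis using closed fY transpose_image_idem[of a Y j] by auto
  next
    case 2
    then have "f ` Y = Y" using fY transpose_image_idem[of a Y j] by auto
    then have "orbit f x \<subseteq> Y" using closed xY by auto
    moreover have "a \<in> orbit f x \<or> j \<in> orbit f x"
      using x orbit_eq_of_mem[OF f] self by blast
    ultimately show ?thesis using 2 by auto
  next
    case 3
    then show ?thesis
      using no_exchange_across_invariant_set[OF inj permutation_image_orbit[OF f, of a] finY, of j a]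
        transpose_image_exchange[of a Y j] fY j self by (auto simp: transpose_commute)
  next
    case 4
    then show ?thesis
      using no_exchange_across_invariant_set[OF inj permutation_image_orbit[OF f, of j] finY, of a j]
        transpose_image_exchange[of j Y a] fY a self by auto
  qed
  with sub show ?thesis unfolding Y_def by auto
qed

lemma orbit_transpose_comp_other:
  assumes "permutation f" "a \<notin> orbit f x" "j \<notin> orbit f x"
  shows "orbit (transpose a j \<circ> f) x = orbit f x"
  using permutation_self_in_orbit[OF assms(1)]
proof (rule orbit_cong)
  fix s assume "s \<in> orbit f x"
  then have "f s \<in> orbit f x" by (rule orbit.step)
  then have "f s \<noteq> a" "f s \<noteq> j" using assms by auto
  then show "(transpose a j \<circ> f) s = f s" by simp
qed

lemma card_cycles_transpose_comp:
  assumes fE: "f permutes E" and E: "finite E" "a \<in> E" "j \<in> E" and a: "a \<notin> orbit f j"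
  shows "card (cycles_on f E) = Suc (card (cycles_on (transpose a j \<circ> f) E))"
proof -
  let ?s = "transpose a j \<circ> f" and ?U = "orbit f a \<union> orbit f j"
  have f: "permutation f" using fE E permutation_permutes by blast
  have self: "y \<in> orbit f y" for y using permutation_self_in_orbit[OF f] .
  have j: "j \<notin> orbit f a" using a orbit_eq_of_mem[OF f] self by metis
  define R where "R = orbit f ` (E - ?U)"
  have UE: "?U \<subseteq> E" using permutes_orbit_subset[OF fE] E by auto
  have notin: "a \<notin> orbit f x" "j \<notin> orbit f x" if "x \<notin> ?U" for x
    using that orbit_eq_of_mem[OF f] self by blast+
  have "cycles_on f E = orbit f ` orbit f a \<union> orbit f ` orbit f j \<union> R"
    unfolding cycles_on_def R_def using UE by blast
  also have "orbit f ` orbit f a = {orbit f a}"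
    using orbit_eq_of_mem[OF f] self by blast
  also have "orbit f ` orbit f j = {orbit f j}"
    using orbit_eq_of_mem[OF f] self by blast
  finally have 1: "cycles_on f E = insert (orbit f a) (insert (orbit f j) R)" by auto
  have "cycles_on ?s E = orbit ?s ` ?U \<union> orbit ?s ` (E - ?U)"
    unfolding cycles_on_def using UE by blast
  also have "orbit ?s ` ?U = {?U}"
    using orbit_transpose_comp_merged[OF f a] self by auto
  also have "orbit ?s ` (E - ?U) = R"
    unfolding R_def using orbit_transpose_comp_other[OF f] notin by (intro image_cong) auto
  finally have 2: "cycles_on ?s E = insert ?U R" by (simp add: o_def)
  have "orbit f a \<notin> R" "orbit f j \<notin> R" "?U \<notin> R" "orbit f a \<noteq> orbit f j" "finite R"
    unfolding R_def using notin self a E by auto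
  then show ?thesis unfolding 1 2 by simp
qed

section \<open>Marked points isolated on their cycles\<close>

text \<open>
  The marked points are \<open>1, \<dots>, d\<close>; those above \<open>j\<close> are required to be separated from all other marked
  points. For \<open>j = d\<close> this is no condition, and for \<open>j = 0\<close> it is the vertex condition of a fully
  simple map.
\<close>

definition isolated :: "(nat \<Rightarrow> nat) \<Rightarrow> nat \<Rightarrow> nat \<Rightarrow> bool" where
  "isolated p d j \<longleftrightarrow> (\<forall>b\<in>{j<..d}. orbit p b \<inter> {1..d} \<subseteq> {b})"

lemma isolated_Suc:
  assumes "j < d"
  shows "isolated p d j \<longleftrightarrow> isolated p d (Suc j) \<and> orbit p (Suc j) \<inter> {1..d} \<subseteq> {Suc j}"
proof -
  have "{j<..d} = insert (Suc j) {Suc j<..d}" using assms by auto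
  then show ?thesis unfolding isolated_def by auto
qed

lemma isolated_transpose_comp:
  assumes f: "permutation f" and "isolated f d j" "j \<le> d" "1 \<le> a" "a \<le> j"
  shows "isolated (transpose a j \<circ> f) d j"
  unfolding isolated_def
proof
  fix b assume b: "b \<in> {j<..d}"
  then have "orbit f b \<inter> {1..d} \<subseteq> {b}" using assms unfolding isolated_def by blast
  then have "a \<notin> orbit f b" "j \<notin> orbit f b" "orbit f b \<inter> {1..d} \<subseteq> {b}" using assms b by auto
  then show "orbit (transpose a j \<circ> f) b \<inter> {1..d} \<subseteq> {b}"
    using orbit_transpose_comp_other[OF f] by simp
qed

lemma transpose_comp_transpose_comp [simp]: "transpose a b \<circ> (transpose a b \<circ> f) = f"
  by (simp add: fun_eq_iff)

text \<open>
  The transposition exchanges \<open>j + 1\<close> with the first marked point \<open>a\<close> met when following the cycle of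
  \<open>j + 1\<close>; this closes the stretch from \<open>j + 1\<close> to the predecessor of \<open>a\<close> into a cycle of its own. Points
  above \<open>j + 1\<close> are isolated already, so they cannot be met, and \<open>a \<le> j + 1\<close>.
\<close>

lemma isolating_transposition_exists:
  assumes p: "permutation p" and iso: "isolated p d (Suc j)" and j: "j < d"
  shows "\<exists>a\<in>{1..Suc j}. isolated (transpose a (Suc j) \<circ> p) d j"
proof -
  let ?j = "Suc j"
  have self: "y \<in> orbit p y" for y using permutation_self_in_orbit[OF p] .
  have "\<exists>n. 0 < n \<and> (p ^^ n) ?j \<in> {1..d}"
    using self[of ?j] j by (auto simp: orbit_altdef)
  then obtain n where n: "0 < n" "(p ^^ n) ?j \<in> {1..d}"
    and least: "\<And>i. 0 < i \<Longrightarrow> i < n \<Longrightarrow> (p ^^ i) ?j \<notin> {1..d}"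
    using exists_least_iff[of "\<lambda>n. 0 < n \<and> (p ^^ n) ?j \<in> {1..d}"] by blast
  define a where "a = (p ^^ n) ?j"
  have aorb: "a \<in> orbit p ?j" unfolding a_def orbit_altdef using n by auto
  have a: "a \<in> {1..?j}"
  proof (rule ccontr)
    assume "a \<notin> {1..?j}"
    then have "orbit p a \<inter> {1..d} \<subseteq> {a}" "a \<noteq> ?j"
      using n iso unfolding isolated_def a_def by auto
    moreover have "?j \<in> orbit p a" using orbit_eq_of_mem[OF p aorb] self by auto
    ultimately show False using j by auto
  qed
  let ?f = "transpose a ?j \<circ> p"
  \<comment> \<open>The stretch of the cycle before \<open>a\<close>, which \<open>?f\<close> closes up.\<close>
  define W where "W = (\<lambda>i. (p ^^ i) ?j) ` {..<n}"
  have step: "?f ((p ^^ i) ?j) \<in> W" if i: "i < n" for i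
  proof (cases "Suc i = n")
    case True
    then have "?f ((p ^^ i) ?j) = (p ^^ 0) ?j" unfolding a_def by auto
    then show ?thesis unfolding W_def using n(1) by (metis imageI lessThan_iff)
  next
    case False
    then have "(p ^^ Suc i) ?j \<notin> {1..d}" using least[of "Suc i"] i by auto
    then have "(p ^^ Suc i) ?j \<noteq> a" "(p ^^ Suc i) ?j \<noteq> ?j" using a j by auto
    then have "?f ((p ^^ i) ?j) = (p ^^ Suc i) ?j" by auto
    then show ?thesis unfolding W_def using False i by (metis Suc_lessI imageI lessThan_iff)
  qed
  have "?j \<in> W" unfolding W_def using n(1) by (intro image_eqI[of _ _ 0]) auto
  then have "orbit ?f ?j \<subseteq> W"
    by (intro orbit_subset_invariant) (use step in \<open>auto simp: W_def\<close>)
  moreover have "W \<inter> {1..d} \<subseteq> {?j}"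
  proof
    fix x assume x: "x \<in> W \<inter> {1..d}"
    then obtain i where "i < n" "x = (p ^^ i) ?j" unfolding W_def by auto
    then show "x \<in> {?j}" using least[of i] x by (cases i) auto
  qed
  ultimately have "orbit ?f ?j \<inter> {1..d} \<subseteq> {?j}" by blast
  moreover have "isolated ?f d ?j" using isolated_transpose_comp[OF p iso] a j by auto
  ultimately show ?thesis using a isolated_Suc[OF j] by blast
qed

text \<open>
  Of two different choices \<open>a\<close> and \<open>b\<close>, let \<open>b\<close> be one that differs from \<open>j + 1\<close>. The cycle \<open>Y\<close> of \<open>j + 1\<close> under \<open>(b j+1) \<circ> p\<close> is mapped by
  \<open>(a j+1) \<circ> p\<close> to \<open>Y\<close> with \<open>j + 1\<close> traded for \<open>b\<close>, although \<open>b\<close> is not on the cycle of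
  \<open>j + 1\<close> under the latter permutation.
\<close>

lemma isolating_transposition_unique:
  assumes p: "permutation p" and j: "j < d" and a: "a \<in> {1..Suc j}" and b: "b \<in> {1..Suc j}"
    and isoa: "isolated (transpose a (Suc j) \<circ> p) d j"
    and isob: "isolated (transpose b (Suc j) \<circ> p) d j"
  shows "a = b"
proof (rule ccontr)
  have impossible: False
    if ne: "a \<noteq> b" "b \<noteq> Suc j" and ab: "a \<in> {1..Suc j}" "b \<in> {1..Suc j}"
      and isoa: "isolated (transpose a (Suc j) \<circ> p) d j"
      and isob: "isolated (transpose b (Suc j) \<circ> p) d j" for a b
  proof -
    let ?j = "Suc j" and ?f = "transpose a (Suc j) \<circ> p" and ?g = "transpose b (Suc j) \<circ> p"
    have f: "permutation ?f" and g: "permutation ?g"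
      using p by (auto intro: permutation_compose permutation_swap_id)
    define Y where "Y = orbit ?g ?j"
    have jY: "?j \<in> Y" unfolding Y_def by (rule permutation_self_in_orbit[OF g])
    have "Y \<inter> {1..d} \<subseteq> {?j}" "orbit ?f ?j \<inter> {1..d} \<subseteq> {?j}"
      using isoa isob isolated_Suc[OF j] unfolding Y_def by auto
    then have Y: "b \<notin> Y" "a \<in> Y \<longleftrightarrow> a = ?j" "b \<notin> orbit ?f ?j" using ne ab j jY by auto
    have "?f ` Y = transpose a ?j ` transpose b ?j ` ?g ` Y"
      by (simp add: image_comp o_def)
    also have "?g ` Y = Y" unfolding Y_def by (rule permutation_image_orbit[OF g])
    also have "transpose b ?j ` Y = insert b (Y - {?j})"
      using transpose_image_exchange jY Y by metis
    also have "transpose a ?j ` insert b (Y - {?j}) = insert b (Y - {?j})"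
      by (cases "a = ?j") (use Y ne in \<open>auto intro!: transpose_image_idem\<close>)
    finally show False
      using no_exchange_across_invariant_set[of ?f "orbit ?f ?j" Y b ?j]
        permutation_image_orbit[OF f] finite_orbit_permutation[OF g] f jY Y(3)
        permutation_self_in_orbit[OF f] unfolding Y_def
      by (simp add: permutation bij_is_inj)
  qed
  assume ne: "a \<noteq> b"
  show False
  proof (cases "b = Suc j")
    case True
    then have "a \<noteq> Suc j" using ne by simp
    then show False by (rule impossible[OF ne[symmetric] _ b a isob isoa])
  next
    case False
    then show False by (rule impossible[OF ne _ a b isoa isob])
  qed
qed

definition isolated_weight :: "nat set \<Rightarrow> nat \<Rightarrow> nat \<Rightarrow> (nat \<Rightarrow> nat) \<Rightarrow> rat fls" where
  "isolated_weight E d j p =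
    (if isolated p d j then fls_X powi (- int (card (cycles_on p E))) else 0)"

lemma fls_X_times_powi_Suc: "fls_X * fls_X powi (- int (Suc n)) = (fls_X :: rat fls) powi (- int n)"
proof -
  have "(fls_X :: rat fls) powi (1 + - int (Suc n)) = fls_X powi 1 * fls_X powi (- int (Suc n))"
    by (rule power_int_add) simp
  moreover have "1 + - int (Suc n) = - int n" by simp
  ultimately show ?thesis by (simp only: power_int_1_right)
qed

text \<open>
  Both sides vanish unless \<open>p\<close> isolates the points above \<open>j + 1\<close>. If it does, exactly one of the \<open>j + 1\<close>
  terms on the right is nonzero. For \<open>a \<le> j\<close> the permutation in that term has one cycle more than \<open>p\<close>,
  because \<open>p\<close> merges the cycles of \<open>a\<close> and \<open>j + 1\<close>; the factor \<open>\<hbar>\<close> accounts for it.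
\<close>

lemma isolated_weight_Suc:
  assumes pE: "p permutes E" and E: "finite E" "{1..d} \<subseteq> E" and j: "j < d"
  shows "isolated_weight E d (Suc j) p = isolated_weight E d j p
    + fls_X * (\<Sum>a\<in>{1..j}. isolated_weight E d j (transpose a (Suc j) \<circ> p))"
proof -
  have p: "permutation p" using pE E permutation_permutes by blast
  let ?t = "\<lambda>a. transpose a (Suc j) \<circ> p"
  have t: "permutation (?t a)" for a using p by (auto intro: permutation_compose permutation_swap_id)
  show ?thesis
  proof (cases "isolated p d (Suc j)")
    case False
    have "\<not> isolated (?t a) d j" if "a \<in> {1..Suc j}" for a
    proof
      assume "isolated (?t a) d j"
      then have "isolated (?t a) d (Suc j)" using isolated_Suc[OF j] by auto
      from isolated_transpose_comp[OF t this, of a] show False using that j False by auto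
    qed
    from this[of "Suc j"] this show ?thesis
      using False unfolding isolated_weight_def by (auto intro!: sum.neutral simp: fun_eq_iff o_def)
  next
    case True
    obtain a where a: "a \<in> {1..Suc j}" and isoa: "isolated (?t a) d j"
      using isolating_transposition_exists[OF p True j] by blast
    have uniq: "\<not> isolated (?t b) d j" if "b \<in> {1..Suc j}" "b \<noteq> a" for b
      using isolating_transposition_unique[OF p j a that(1) isoa] that by blast
    show ?thesis
    proof (cases "a = Suc j")
      case True
      have "(\<Sum>b\<in>{1..j}. isolated_weight E d j (?t b)) = 0"
        by (rule sum.neutral) (use uniq True in \<open>auto simp: isolated_weight_def\<close>)
      then show ?thesis using True isoa \<open>isolated p d (Suc j)\<close>
        by (simp add: isolated_weight_def o_def)
    next
      case False
      then have aj: "a \<in> {1..j}" using a by auto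
      have "\<not> isolated p d j" using uniq[of "Suc j"] False by (auto simp: o_def)
      moreover have "(\<Sum>b\<in>{1..j}. isolated_weight E d j (?t b)) =
          (\<Sum>b\<in>{1..j}. if b = a then isolated_weight E d j (?t a) else 0)"
        by (rule sum.cong) (use uniq in \<open>auto simp: isolated_weight_def\<close>)
      moreover have "card (cycles_on (?t a) E) = Suc (card (cycles_on p E))"
      proof -
        have "?t a permutes E"
          using pE E a j by (intro permutes_compose permutes_swap_id) auto
        moreover have "a \<notin> orbit (?t a) (Suc j)"
          using isoa isolated_Suc[OF j] aj j by fastforce
        moreover have "a \<in> E" "Suc j \<in> E" using E a j by (auto intro!: subsetD[OF E(2)])
        ultimately show ?thesis
          using card_cycles_transpose_comp[of "?t a" E a "Suc j"] E by simp
      qed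
      ultimately have "\<not> isolated p d j"
        "(\<Sum>b\<in>{1..j}. isolated_weight E d j (?t b)) = fls_X powi (- int (Suc (card (cycles_on p E))))"
        using aj isoa by (simp_all add: isolated_weight_def)
      then show ?thesis
        using True by (simp only: isolated_weight_def fls_X_times_powi_Suc if_True if_False add_0_left)
    qed
  qed
qed

section \<open>Weakly monotone factorizations\<close>

definition monotone_factorizations ::
  "nat \<Rightarrow> nat \<Rightarrow> (nat \<Rightarrow> nat) \<Rightarrow> (nat \<Rightarrow> nat) list set" where
  "monotone_factorizations j k \<pi> =
    {\<tau>s. length \<tau>s = k \<and> weakly_monotone j \<tau>s \<and> foldr (\<circ>) \<tau>s id = \<pi>}"

lemma finite_monotone_factorizations: "finite (monotone_factorizations j k \<pi>)"
proof (rule finite_subset)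
  show "monotone_factorizations j k \<pi> \<subseteq> map (\<lambda>(a, b). transpose a b) `
      {ps. set ps \<subseteq> {1..j} \<times> {1..j} \<and> length ps = k}"
  proof
    fix \<tau>s assume "\<tau>s \<in> monotone_factorizations j k \<pi>"
    then obtain ps where ps: "\<tau>s = map (\<lambda>(a, b). transpose a b) ps" "length \<tau>s = k"
      "\<forall>(a, b)\<in>set ps. 1 \<le> a \<and> a < b \<and> b \<le> j"
      unfolding monotone_factorizations_def weakly_monotone_def by auto
    then have "set ps \<subseteq> {1..j} \<times> {1..j}" by fastforce
    then show "\<tau>s \<in> map (\<lambda>(a, b). transpose a b) ` {ps. set ps \<subseteq> {1..j} \<times> {1..j} \<and> length ps = k}"
      using ps(1,2) by auto
  qed
qed (intro finite_imageI finite_lists_length_eq finite_cartesian_product finite_atLeastAtMost)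

lemma foldr_comp_snoc: "foldr (\<circ>) (\<tau>s @ [t]) id = foldr (\<circ>) \<tau>s id \<circ> t"
proof (induction \<tau>s)
  case (Cons x \<tau>s) then show ?case by (simp only: append_Cons foldr_Cons o_apply comp_assoc)
qed simp

lemma permutes_foldr_comp:
  assumes "weakly_monotone j \<tau>s" shows "foldr (\<circ>) \<tau>s id permutes {1..j}"
proof -
  have "\<forall>t\<in>set \<tau>s. t permutes {1..j}"
  proof
    fix t assume "t \<in> set \<tau>s"
    then obtain a b where "t = transpose a b" "1 \<le> a" "a < b" "b \<le> j"
      using assms unfolding weakly_monotone_def by fastforce
    then show "t permutes {1..j}" by (auto intro: permutes_swap_id)
  qed
  then show ?thesis
  proof (induction \<tau>s)
    case (Cons t \<tau>s)
    have "foldr (\<circ>) \<tau>s id permutes {1..j}" by (rule Cons.IH) (use Cons.prems in simp)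
    then have "t \<circ> foldr (\<circ>) \<tau>s id permutes {1..j}"
      by (rule permutes_compose) (use Cons.prems in simp)
    then show ?case by (simp only: foldr_Cons comp_apply[of "(\<circ>) t"])
  qed simp
qed

text \<open>
  Monotonicity makes the last transposition the one with the largest upper entry, so either that entry
  is \<open>j + 1\<close>, with no condition on the earlier ones, or \<open>j + 1\<close> does not occur at all.
\<close>

lemma weakly_monotone_snoc:
  "weakly_monotone (Suc j) (\<tau>s @ [t]) \<longleftrightarrow> weakly_monotone j (\<tau>s @ [t]) \<or>
    weakly_monotone (Suc j) \<tau>s \<and> (\<exists>a\<in>{1..j}. t = transpose a (Suc j))"
proof (intro iffI; (elim disjE conjE bexE)?)
  assume "weakly_monotone (Suc j) (\<tau>s @ [t])"
  then obtain ps where ps: "\<tau>s @ [t] = map (\<lambda>(a, b). transpose a b) ps"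
    "\<forall>(a, b)\<in>set ps. 1 \<le> a \<and> a < b \<and> b \<le> Suc j" "sorted (map snd ps)"
    unfolding weakly_monotone_def by auto
  then obtain qs a b where qs: "ps = qs @ [(a, b)]"
    by (metis append_is_Nil_conv list.simps(8) not_Cons_self2 rev_exhaust surj_pair)
  have eq: "\<tau>s = map (\<lambda>(a, b). transpose a b) qs" "t = transpose a b" using ps(1) qs by auto
  have ab: "1 \<le> a" "a < b" "b \<le> Suc j" using ps(2) qs by auto
  have le: "\<forall>(x, y)\<in>set qs. y \<le> b" using ps(3) qs by (auto simp: sorted_append)
  show "weakly_monotone j (\<tau>s @ [t]) \<or>
    weakly_monotone (Suc j) \<tau>s \<and> (\<exists>a\<in>{1..j}. t = transpose a (Suc j))"
  proof (cases "b = Suc j")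
    case True
    have "weakly_monotone (Suc j) \<tau>s" unfolding weakly_monotone_def
      using eq ps(2,3) qs by (intro exI[of _ qs]) (auto simp: sorted_append)
    then show ?thesis using eq(2) ab True by auto
  next
    case False
    have "weakly_monotone j (\<tau>s @ [t])" unfolding weakly_monotone_def
      using ps qs le ab False by (intro exI[of _ ps]) fastforce
    then show ?thesis by blast
  qed
next
  assume "weakly_monotone j (\<tau>s @ [t])"
  then show "weakly_monotone (Suc j) (\<tau>s @ [t])"
    unfolding weakly_monotone_def by fastforce
next
  fix a assume "weakly_monotone (Suc j) \<tau>s" and a: "a \<in> {1..j}" "t = transpose a (Suc j)"
  then obtain ps where "\<tau>s = map (\<lambda>(a, b). transpose a b) ps"
    "\<forall>(a, b)\<in>set ps. 1 \<le> a \<and> a < b \<and> b \<le> Suc j" "sorted (map snd ps)"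
    unfolding weakly_monotone_def by auto
  then show "weakly_monotone (Suc j) (\<tau>s @ [t])" unfolding weakly_monotone_def
    using a by (intro exI[of _ "ps @ [(a, Suc j)]"]) (auto simp: sorted_append)
qed

lemma monotone_factorizations_0:
  "monotone_factorizations j 0 \<pi> = (if \<pi> = id then {[]} else {})"
  unfolding monotone_factorizations_def weakly_monotone_def by auto

lemma monotone_factorizations_no_points:
  "monotone_factorizations 0 (Suc k) \<pi> = {}"
  unfolding monotone_factorizations_def weakly_monotone_def by (auto simp: length_Suc_conv)

lemma comp_transpose_eq_iff: "f \<circ> transpose a b = g \<longleftrightarrow> f = g \<circ> transpose a b"
  by (auto simp: fun_eq_iff) (metis transpose_involutory)+

lemma weakly_monotone_last_fixes:
  assumes "weakly_monotone j (\<tau>s @ [t])" shows "t (Suc j) = Suc j"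
  using assms unfolding weakly_monotone_def
  by (auto simp: map_eq_append_conv append_eq_map_conv intro!: transpose_apply_other)

lemma card_monotone_factorizations_Suc:
  "card (monotone_factorizations (Suc j) (Suc k) \<pi>) = card (monotone_factorizations j (Suc k) \<pi>)
    + (\<Sum>a\<in>{1..j}. card (monotone_factorizations (Suc j) k (\<pi> \<circ> transpose a (Suc j))))"
proof -
  let ?t = "\<lambda>a. transpose a (Suc j)"
  let ?A = "\<lambda>a. (\<lambda>\<tau>s. \<tau>s @ [?t a]) ` monotone_factorizations (Suc j) k (\<pi> \<circ> ?t a)"
  have eq: "monotone_factorizations (Suc j) (Suc k) \<pi> =
      monotone_factorizations j (Suc k) \<pi> \<union> (\<Union>a\<in>{1..j}. ?A a)" (is "?L = ?R")
  proof (intro set_eqI)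
    fix \<tau>s
    show "\<tau>s \<in> ?L \<longleftrightarrow> \<tau>s \<in> ?R"
    proof (cases \<tau>s rule: rev_cases)
      case Nil then show ?thesis by (auto simp: monotone_factorizations_def)
    next
      case (snoc \<rho>s t)
      have A: "\<rho>s @ [t] \<in> ?A a \<longleftrightarrow> t = ?t a \<and> length \<rho>s = k \<and> weakly_monotone (Suc j) \<rho>s
          \<and> foldr (\<circ>) \<rho>s id \<circ> t = \<pi>" for a
        unfolding monotone_factorizations_def
        by (auto simp: comp_transpose_eq_iff comp_assoc intro!: imageI)
      show ?thesis unfolding snoc Un_iff UN_iff A
        unfolding monotone_factorizations_def mem_Collect_eq foldr_comp_snoc weakly_monotone_snoc
        by auto
    qed
  qed
  have disj: "?A a \<inter> ?A b = {}" if "a \<noteq> b" for a b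
    using that by (auto dest!: arg_cong[of "transpose _ _" _ "\<lambda>f. f (Suc j)"])
  have "monotone_factorizations j (Suc k) \<pi> \<inter> (\<Union>a\<in>{1..j}. ?A a) = {}"
  proof -
    have "?t a (Suc j) = Suc j" if "\<tau>s @ [?t a] \<in> monotone_factorizations j (Suc k) \<pi>" for \<tau>s a
      using that weakly_monotone_last_fixes unfolding monotone_factorizations_def by blast
    then show ?thesis by fastforce
  qed
  then have "card ?L = card (monotone_factorizations j (Suc k) \<pi>) + card (\<Union>a\<in>{1..j}. ?A a)"
    unfolding eq by (intro card_Un_disjoint finite_monotone_factorizations finite_UN_I finite_imageI) auto
  also have "card (\<Union>a\<in>{1..j}. ?A a) = (\<Sum>a\<in>{1..j}. card (?A a))"
    using disj by (intro card_UN_disjoint) (auto intro: finite_monotone_factorizations)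
  also have "\<dots> = (\<Sum>a\<in>{1..j}. card (monotone_factorizations (Suc j) k (\<pi> \<circ> ?t a)))"
    by (intro sum.cong refl card_image inj_onI) auto
  finally show ?thesis .
qed

text \<open>
  The generating series with \<open>\<hbar>\<close> replaced by \<open>-\<hbar>\<close>.
\<close>

definition monotone_gf :: "nat \<Rightarrow> (nat \<Rightarrow> nat) \<Rightarrow> rat fps" where
  "monotone_gf j \<pi> = Abs_fps (\<lambda>k. (-1) ^ k * of_nat (card (monotone_factorizations j k \<pi>)))"

lemma monotone_gf_no_points: "monotone_gf 0 \<pi> = (if \<pi> = id then 1 else 0)"
proof (rule fps_ext)
  fix k show "monotone_gf 0 \<pi> $ k = (if \<pi> = id then 1 else 0) $ k"
    by (cases k) (auto simp: monotone_gf_def monotone_factorizations_0 monotone_factorizations_no_points)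
qed

text \<open>
  The factorizations that use \<open>j + 1\<close> lose their last transposition \<open>(a j+1)\<close>, and with it one power of
  \<open>-\<hbar>\<close>. In the group algebra this reads \<open>g\<^sub>j = g\<^sub>j\<^sub>+\<^sub>1 (1 + \<hbar> J)\<close> with \<open>J\<close> the sum of these
  transpositions: passing from \<open>j\<close> to \<open>j + 1\<close> multiplies \<open>g\<close> by the inverse of \<open>1 + \<hbar> J\<close>.
\<close>

lemma monotone_gf_Suc:
  "monotone_gf j \<pi> = monotone_gf (Suc j) \<pi>
    + fps_X * (\<Sum>a\<in>{1..j}. monotone_gf (Suc j) (\<pi> \<circ> transpose a (Suc j)))"
proof (rule fps_ext)
  fix k
  show "monotone_gf j \<pi> $ k = (monotone_gf (Suc j) \<pi>
    + fps_X * (\<Sum>a\<in>{1..j}. monotone_gf (Suc j) (\<pi> \<circ> transpose a (Suc j)))) $ k"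
  proof (cases k)
    case 0 then show ?thesis by (auto simp: monotone_gf_def monotone_factorizations_0)
  next
    case (Suc k')
    then show ?thesis
      by (simp add: monotone_gf_def card_monotone_factorizations_Suc fps_sum_nth sum_distrib_left
          sum_negf algebra_simps)
  qed
qed

lemma fps_to_fls_sum: "fps_to_fls (sum f A) = (\<Sum>x\<in>A. fps_to_fls (f x))"
  by (induction A rule: infinite_finite_induct) auto

text \<open>
  The value of the sum does not change with \<open>j\<close>: the factor \<open>1 + \<hbar> J\<close> that turns the weight for \<open>j\<close> into
  the weight for \<open>j + 1\<close> can be moved to \<open>g\<^sub>j\<^sub>+\<^sub>1\<close> by the substitution \<open>\<pi> \<mapsto> \<pi> \<circ> (a j+1)\<close>, and it turns
  \<open>g\<^sub>j\<^sub>+\<^sub>1\<close> back into \<open>g\<^sub>j\<close>. At \<open>j = 0\<close> only \<open>\<pi> = id\<close> contributes.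
\<close>

lemma sum_monotone_gf_isolated_weight:
  assumes E: "finite E" "{1..d} \<subseteq> E" and j: "j \<le> d" and \<sigma>: "\<sigma> permutes E"
  shows "(\<Sum>\<pi>\<in>{\<pi>. \<pi> permutes {1..d}}. fps_to_fls (monotone_gf j \<pi>) * isolated_weight E d j (inv \<pi> \<circ> \<sigma>))
    = isolated_weight E d 0 \<sigma>"
  using j
proof (induction j)
  case 0
  have "(\<Sum>\<pi>\<in>{\<pi>. \<pi> permutes {1..d}}. fps_to_fls (monotone_gf 0 \<pi>) * isolated_weight E d 0 (inv \<pi> \<circ> \<sigma>))
    = (\<Sum>\<pi>\<in>{\<pi>. \<pi> permutes {1..d}}. if \<pi> = id then isolated_weight E d 0 \<sigma> else 0)"
    by (intro sum.cong) (auto simp: monotone_gf_no_points)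
  also have "\<dots> = isolated_weight E d 0 \<sigma>" by (simp add: finite_permutations)
  finally show ?case .
next
  case (Suc j)
  let ?S = "{\<pi>. \<pi> permutes {1..d}}" and ?t = "\<lambda>a. transpose a (Suc j)"
  let ?g = "\<lambda>j \<pi>. fps_to_fls (monotone_gf j \<pi>)" and ?w = "\<lambda>j \<pi>. isolated_weight E d j (inv \<pi> \<circ> \<sigma>)"
  have w: "?w (Suc j) \<pi> = ?w j \<pi> + fls_X * (\<Sum>a\<in>{1..j}. ?w j (\<pi> \<circ> ?t a))" if "\<pi> \<in> ?S" for \<pi>
  proof -
    have pi: "\<pi> permutes {1..d}" using that by simp
    then have "inv \<pi> permutes E" using E(2) permutes_inv permutes_subset by blast
    then have "inv \<pi> \<circ> \<sigma> permutes E" using \<sigma> by (rule permutes_compose[rotated])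
    from isolated_weight_Suc[OF this E] Suc.prems
    have "?w (Suc j) \<pi> = ?w j \<pi>
        + fls_X * (\<Sum>a\<in>{1..j}. isolated_weight E d j (?t a \<circ> (inv \<pi> \<circ> \<sigma>)))" by simp
    moreover have "?t a \<circ> (inv \<pi> \<circ> \<sigma>) = inv (\<pi> \<circ> ?t a) \<circ> \<sigma>" for a
      by (simp add: o_inv_distrib permutes_bij[OF pi] comp_assoc)
    ultimately show ?thesis by simp
  qed
  have shift: "(\<Sum>\<pi>\<in>?S. ?g (Suc j) \<pi> * ?w j (\<pi> \<circ> ?t a)) = (\<Sum>\<pi>\<in>?S. ?g (Suc j) (\<pi> \<circ> ?t a) * ?w j \<pi>)"
    if "a \<in> {1..j}" for a
    using that Suc.prems
    by (intro sum.reindex_bij_witness[where i = "\<lambda>\<pi>. \<pi> \<circ> ?t a" and j = "\<lambda>\<pi>. \<pi> \<circ> ?t a"])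
      (auto simp: comp_assoc simp del: o_apply intro!: permutes_compose permutes_swap_id)
  have swap: "(\<Sum>\<pi>\<in>?S. \<Sum>a\<in>{1..j}. ?g (Suc j) \<pi> * ?w j (\<pi> \<circ> ?t a))
      = (\<Sum>\<pi>\<in>?S. \<Sum>a\<in>{1..j}. ?g (Suc j) (\<pi> \<circ> ?t a) * ?w j \<pi>)"
    by (subst (1 2) sum.swap) (rule sum.cong[OF refl], rule shift)
  have "(\<Sum>\<pi>\<in>?S. ?g (Suc j) \<pi> * ?w (Suc j) \<pi>) = (\<Sum>\<pi>\<in>?S. ?g (Suc j) \<pi> * ?w j \<pi>)
      + fls_X * (\<Sum>\<pi>\<in>?S. \<Sum>a\<in>{1..j}. ?g (Suc j) \<pi> * ?w j (\<pi> \<circ> ?t a))"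
    unfolding sum_distrib_left sum.distrib[symmetric]
    by (intro sum.cong) (auto simp: w algebra_simps sum_distrib_left simp del: o_apply)
  also note swap
  also have "(\<Sum>\<pi>\<in>?S. ?g (Suc j) \<pi> * ?w j \<pi>)
      + fls_X * (\<Sum>\<pi>\<in>?S. \<Sum>a\<in>{1..j}. ?g (Suc j) (\<pi> \<circ> ?t a) * ?w j \<pi>) = (\<Sum>\<pi>\<in>?S. ?g j \<pi> * ?w j \<pi>)"
    unfolding sum_distrib_left sum.distrib[symmetric]
  proof (intro sum.cong refl)
    fix \<pi>
    show "?g (Suc j) \<pi> * ?w j \<pi> + (\<Sum>a\<in>{1..j}. fls_X * (?g (Suc j) (\<pi> \<circ> ?t a) * ?w j \<pi>))
      = ?g j \<pi> * ?w j \<pi>"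
      by (subst monotone_gf_Suc[of j \<pi>])
        (simp add: fls_times_fps_to_fls fps_to_fls_sum algebra_simps sum_distrib_left sum_distrib_right)
  qed
  also have "\<dots> = isolated_weight E d 0 \<sigma>" by (rule Suc.IH) (use Suc.prems in simp)
  finally show ?case .
qed

section \<open>Permutations with chosen points on their cycles\<close>

text \<open>
  When the \<open>\<mu>\<^sub>i\<close> add up to the number of points, such a list picks one point on every cycle. A bijection
  that intertwines two permutations is then determined by its values on the list, and these can be
  prescribed freely.
\<close>

definition is_rooting :: "('a \<Rightarrow> 'a) \<Rightarrow> nat list \<Rightarrow> 'a list \<Rightarrow> bool" where
  "is_rooting p \<mu> R \<longleftrightarrow> distinct (map (orbit p) R) \<and> map (\<lambda>r. card (orbit p r)) R = \<mu>"

lemma orbit_enumeration: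
  assumes "permutation p"
  shows "bij_betw (\<lambda>i. (p ^^ i) r) {..<card (orbit p r)} (orbit p r)"
    and "(p ^^ card (orbit p r)) r = r"
proof -
  have self: "r \<in> orbit p r" using permutation_self_in_orbit[OF assms] .
  let ?D = "funpow_dist1 p r r"
  have "bij_betw (\<lambda>i. (p ^^ i) r) {0..<?D} (orbit p r)"
    unfolding bij_betw_def using inj_on_funpow_dist1[OF self] orbit_conv_funpow_dist1[OF self] by auto
  moreover from this have "card (orbit p r) = ?D" using bij_betw_same_card by fastforce
  ultimately show "bij_betw (\<lambda>i. (p ^^ i) r) {..<card (orbit p r)} (orbit p r)"
    and "(p ^^ card (orbit p r)) r = r"
    using funpow_dist1_prop[OF self] by (simp_all add: atLeast0LessThan)
qed

lemma orbit_intertwiner_exists: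
  assumes p: "permutation p" and q: "permutation q" and card: "card (orbit p r) = card (orbit q s)"
  shows "\<exists>\<beta>. bij_betw \<beta> (orbit p r) (orbit q s) \<and> (\<forall>x\<in>orbit p r. \<beta> (p x) = q (\<beta> x)) \<and> \<beta> r = s"
proof -
  define n where "n = card (orbit p r)"
  let ?f = "\<lambda>i. (p ^^ i) r" and ?g = "\<lambda>i. (q ^^ i) s"
  have f: "bij_betw ?f {..<n} (orbit p r)" "?f n = r"
    using orbit_enumeration[OF p] unfolding n_def by auto
  have g: "bij_betw ?g {..<n} (orbit q s)" "?g n = s"
    using orbit_enumeration[OF q] unfolding n_def card by auto
  define \<beta> where "\<beta> = ?g \<circ> inv_into {..<n} ?f"
  have bij: "bij_betw \<beta> (orbit p r) (orbit q s)"
    unfolding \<beta>_def by (rule bij_betw_trans[OF bij_betw_inv_into[OF f(1)] g(1)])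
  have val: "\<beta> (?f i) = ?g i" if "i < n" for i
    using that bij_betw_inv_into_left[OF f(1)] unfolding \<beta>_def by simp
  have "n > 0" using f(1) orbit_nonempty[of p r] by (cases n) (auto simp: bij_betw_def)
  then have 0: "\<beta> r = s" using val[of 0] by simp
  have "\<beta> (p x) = q (\<beta> x)" if "x \<in> orbit p r" for x
  proof -
    have "x \<in> ?f ` {..<n}" using f(1) that by (simp add: bij_betw_def)
    then obtain i where i: "i < n" "x = ?f i" by blast
    show ?thesis
    proof (cases "Suc i = n")
      case True
      then have "p x = r" "q (?g i) = s" using f(2) g(2) i by auto
      then show ?thesis using 0 val i by simp
    next
      case False then show ?thesis using val[of "Suc i"] val[of i] i by simp
    qed
  qed
  then show ?thesis using bij 0 by blast
qed

lemma rooted_intertwiner_exists: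
  assumes p: "permutation p" and q: "permutation q"
    and "is_rooting p \<mu> R" "is_rooting q \<mu> R'"
  shows "\<exists>\<beta>. bij_betw \<beta> (\<Union>r\<in>set R. orbit p r) (\<Union>r\<in>set R'. orbit q r) \<and>
    (\<forall>x\<in>(\<Union>r\<in>set R. orbit p r). \<beta> (p x) = q (\<beta> x)) \<and> map \<beta> R = R'"
  using assms(3,4)
proof (induction \<mu> arbitrary: R R')
  case Nil then show ?case by (auto simp: is_rooting_def bij_betw_def)
next
  case (Cons m \<mu>)
  obtain r S where R: "R = r # S" using Cons.prems(1) by (cases R) (auto simp: is_rooting_def)
  obtain r' S' where R': "R' = r' # S'" using Cons.prems(2) by (cases R') (auto simp: is_rooting_def)
  have "is_rooting p \<mu> S" "is_rooting q \<mu> S'" using Cons.prems R R' by (auto simp: is_rooting_def)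
  then obtain \<gamma> where \<gamma>: "bij_betw \<gamma> (\<Union>r\<in>set S. orbit p r) (\<Union>r\<in>set S'. orbit q r)"
    "\<forall>x\<in>(\<Union>r\<in>set S. orbit p r). \<gamma> (p x) = q (\<gamma> x)" "map \<gamma> S = S'"
    using Cons.IH by blast
  have "card (orbit p r) = card (orbit q r')" using Cons.prems R R' by (auto simp: is_rooting_def)
  then obtain \<delta> where \<delta>: "bij_betw \<delta> (orbit p r) (orbit q r')"
    "\<forall>x\<in>orbit p r. \<delta> (p x) = q (\<delta> x)" "\<delta> r = r'"
    using orbit_intertwiner_exists[OF p q] by blast
  have disj: "orbit p r \<inter> (\<Union>r\<in>set S. orbit p r) = {}"
  proof -
    have "orbit p r \<noteq> orbit p s" if "s \<in> set S" for s
      using Cons.prems(1) that by (auto simp: R is_rooting_def)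
    then show ?thesis using orbit_eq_of_mem[OF p] by blast
  qed
  have disj': "orbit q r' \<inter> (\<Union>r\<in>set S'. orbit q r) = {}"
  proof -
    have "orbit q r' \<noteq> orbit q s" if "s \<in> set S'" for s
      using Cons.prems(2) that by (auto simp: R' is_rooting_def)
    then show ?thesis using orbit_eq_of_mem[OF q] by blast
  qed
  define \<beta> where "\<beta> = (\<lambda>x. if x \<in> orbit p r then \<delta> x else \<gamma> x)"
  have \<beta>1: "\<beta> x = \<delta> x" if "x \<in> orbit p r" for x using that by (simp add: \<beta>_def)
  have \<beta>2: "\<beta> x = \<gamma> x" if "x \<in> (\<Union>r\<in>set S. orbit p r)" for x using that disj by (auto simp: \<beta>_def)
  have "bij_betw \<beta> (orbit p r \<union> (\<Union>r\<in>set S. orbit p r)) (orbit q r' \<union> (\<Union>r\<in>set S'. orbit q r))"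
    using \<delta>(1) \<gamma>(1) disj' bij_betw_cong[of "orbit p r" \<beta> \<delta>]
      bij_betw_cong[of "\<Union>r\<in>set S. orbit p r" \<beta> \<gamma>] \<beta>1 \<beta>2
    by (intro bij_betw_combine) simp_all
  moreover have "\<beta> (p x) = q (\<beta> x)" if "x \<in> (\<Union>r\<in>set R. orbit p r)" for x
  proof (cases "x \<in> orbit p r")
    case True then show ?thesis using \<delta>(2) \<beta>1 by (simp add: orbit.step)
  next
    case False
    then have x: "x \<in> (\<Union>r\<in>set S. orbit p r)" using that R by auto
    then have "p x \<in> (\<Union>r\<in>set S. orbit p r)" by (auto intro: orbit.step)
    then have "\<beta> (p x) = \<gamma> (p x)" "\<beta> x = \<gamma> x" using \<beta>2 x by blast+
    moreover have "\<gamma> (p x) = q (\<gamma> x)" using \<gamma>(2) x by blast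
    ultimately show ?thesis by simp
  qed
  moreover have "map \<beta> R = R'"
  proof -
    have "map \<beta> S = map \<gamma> S"
      using \<beta>2 permutation_self_in_orbit[OF p] by (intro map_cong) auto
    then show ?thesis using \<delta>(3) \<gamma>(3) \<beta>1 permutation_self_in_orbit[OF p] by (simp add: R R')
  qed
  ultimately show ?case by (auto simp: R R')
qed

lemma intertwiners_agree_on_orbit:
  assumes "r \<in> orbit p r" "\<beta> r = \<gamma> r" "x \<in> orbit p r"
    and "\<And>x. x \<in> orbit p r \<Longrightarrow> \<beta> (p x) = q (\<beta> x)" "\<And>x. x \<in> orbit p r \<Longrightarrow> \<gamma> (p x) = q (\<gamma> x)"
  shows "\<beta> x = \<gamma> x"
  using assms(3) by induct (use assms in auto)

lemma rooting_covers:
  assumes p: "p permutes A" and A: "finite A" "card A = sum_list \<mu>" and R: "set R \<subseteq> A" "is_rooting p \<mu> R"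
  shows "(\<Union>r\<in>set R. orbit p r) = A"
proof -
  have perm: "permutation p" using p A permutation_permutes by blast
  have "card (\<Union>(set (map (orbit p) R))) = (\<Sum>C\<in>set (map (orbit p) R). card C)"
    by (rule card_Union_disjoint)
      (auto simp: pairwise_def disjnt_def finite_orbit_permutation[OF perm] dest: orbit_eq_of_mem[OF perm])
  also have "\<dots> = sum_list (map card (map (orbit p) R))"
    using R(2) by (intro sum.distinct_set_conv_list) (simp add: is_rooting_def)
  also have "\<dots> = sum_list \<mu>" using R(2) by (auto simp: is_rooting_def o_def)
  finally have "card (\<Union>r\<in>set R. orbit p r) = card A" using A by simp
  then show ?thesis
    using R(1) permutes_orbit_subset[OF p] A by (intro card_subset_eq) auto
qed

lemma cycles_on_rooting:
  assumes p: "p permutes A" and A: "finite A" "card A = sum_list \<mu>" and R: "set R \<subseteq> A" "is_rooting p \<mu> R"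
  shows "cycles_on p A = set (map (orbit p) R)"
proof -
  have perm: "permutation p" using p A permutation_permutes by blast
  then show ?thesis
    unfolding cycles_on_def rooting_covers[OF assms, symmetric] set_map
    using orbit_eq_of_mem[OF perm] permutation_self_in_orbit[OF perm] by blast
qed

lemma cycle_type_on_rooting:
  assumes p: "p permutes A" and A: "finite A" "card A = sum_list \<mu>" and R: "set R \<subseteq> A" "is_rooting p \<mu> R"
  shows "cycle_type_on p A = mset \<mu>"
proof -
  have "cycles_on p A = set (map (orbit p) R)" by (rule cycles_on_rooting[OF assms])
  then have "mset_set (cycles_on p A) = mset (map (orbit p) R)"
    using R(2) unfolding is_rooting_def by (simp only: mset_set_set)
  then show ?thesis using R(2) unfolding cycle_type_on_def is_rooting_def by (auto simp: image_mset.compositionality o_def)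
qed

lemma z_partition_Cons: "z_partition (m # \<mu>) = m * count_list (m # \<mu>) m * z_partition \<mu>"
proof -
  let ?S = "insert m (set \<mu>)"
  have "(\<Prod>j\<in>set \<mu>. fact (count_list \<mu> j)) = (\<Prod>j\<in>?S. fact (count_list \<mu> j) :: nat)"
    by (rule prod.mono_neutral_left) auto
  also have "\<dots> = fact (count_list \<mu> m) * (\<Prod>j\<in>?S - {m}. fact (count_list \<mu> j))"
    by (rule prod.remove) auto
  finally have 1: "(\<Prod>j\<in>set \<mu>. fact (count_list \<mu> j) :: nat) =
      fact (count_list \<mu> m) * (\<Prod>j\<in>?S - {m}. fact (count_list \<mu> j))" .
  have "(\<Prod>j\<in>?S. fact (count_list (m # \<mu>) j) :: nat)
      = fact (count_list (m # \<mu>) m) * (\<Prod>j\<in>?S - {m}. fact (count_list (m # \<mu>) j))"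
    by (rule prod.remove) auto
  also have "(\<Prod>j\<in>?S - {m}. fact (count_list (m # \<mu>) j) :: nat) = (\<Prod>j\<in>?S - {m}. fact (count_list \<mu> j))"
    by (rule prod.cong) auto
  finally show ?thesis unfolding z_partition_def 1 by (simp add: algebra_simps)
qed

text \<open>
  The list chooses an ordering of the fibres of \<open>f\<close> by which their sizes read \<open>\<mu>\<close>, and a point of each
  fibre. The first entry has \<open>m\<close> times the number of fibres of size \<open>m\<close> choices, which is the factor
  by which \<open>z\<close> grows when \<open>m\<close> is put in front of \<open>\<mu>\<close>.
\<close>

lemma card_transversal_lists:
  assumes "finite A" "\<And>c. c \<in> f ` A \<Longrightarrow> w c = card {x \<in> A. f x = c}"
    and "image_mset w (mset_set (f ` A)) = mset \<mu>"
  shows "card {R. set R \<subseteq> A \<and> distinct (map f R) \<and> map (\<lambda>r. w (f r)) R = \<mu>} = z_partition \<mu>"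
  using assms
proof (induction \<mu> arbitrary: A)
  case Nil
  then have "A = {}" by (simp add: mset_set_empty_iff)
  moreover have "{R. set R \<subseteq> {} \<and> distinct (map f R) \<and> map (\<lambda>r. w (f r)) R = []} = {[]}" by auto
  ultimately show ?case by (simp add: z_partition_def)
next
  case (Cons m \<mu>)
  note fin = Cons.prems(1) and w = Cons.prems(2) and mset = Cons.prems(3)
  \<comment> \<open>After a first entry \<open>r\<close> from the fibres of size \<open>m\<close>, the list continues outside the fibre of \<open>r\<close>.\<close>
  define T where "T = (\<lambda>A \<mu>. {R. set R \<subseteq> A \<and> distinct (map f R) \<and> map (\<lambda>r. w (f r)) R = \<mu>})"
  define B where "B = (\<lambda>r. {x \<in> A. f x \<noteq> f r})"
  define H where "H = {r \<in> A. w (f r) = m}"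
  have eq: "T A (m # \<mu>) = (\<lambda>(r, R). r # R) ` (SIGMA r:H. T (B r) \<mu>)"
  proof (intro set_eqI)
    fix R show "R \<in> T A (m # \<mu>) \<longleftrightarrow> R \<in> (\<lambda>(r, R). r # R) ` (SIGMA r:H. T (B r) \<mu>)"
      by (cases R) (auto simp: T_def B_def H_def image_iff)
  qed
  have card_T: "card (T (B r) \<mu>) = z_partition \<mu>" if r: "r \<in> H" for r
    unfolding T_def
  proof (rule Cons.IH)
    show "finite (B r)" using fin by (simp add: B_def)
    show "w c = card {x \<in> B r. f x = c}" if c: "c \<in> f ` B r" for c
    proof -
      have "{x \<in> B r. f x = c} = {x \<in> A. f x = c}" using c by (auto simp: B_def)
      then show ?thesis using w c by (auto simp: B_def)
    qed
    have "f ` A = insert (f r) (f ` B r)" "f r \<notin> f ` B r" using r by (auto simp: B_def H_def)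
    then have "image_mset w (mset_set (f ` A)) = add_mset m (image_mset w (mset_set (f ` B r)))"
      using fin r by (simp add: B_def H_def)
    then show "image_mset w (mset_set (f ` B r)) = mset \<mu>" using mset by simp
  qed
  have finT: "finite (T (B r) \<mu>)" for r
  proof (rule finite_subset)
    show "T (B r) \<mu> \<subseteq> {R. set R \<subseteq> A \<and> length R = length \<mu>}" by (auto simp: T_def B_def)
  qed (use fin finite_lists_length_eq in blast)
  have "card (T A (m # \<mu>)) = card (SIGMA r:H. T (B r) \<mu>)"
    unfolding eq by (rule card_image) (auto simp: inj_on_def)
  also have "\<dots> = (\<Sum>r\<in>H. card (T (B r) \<mu>))"
    using fin finT by (intro card_SigmaI) (auto simp: H_def)
  also have "\<dots> = card H * z_partition \<mu>" using card_T by simp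
  also have "card H = m * count_list (m # \<mu>) m"
  proof -
    define K where "K = {c \<in> f ` A. w c = m}"
    have "H = (\<Union>c\<in>K. {x \<in> A. f x = c})" by (auto simp: H_def K_def)
    also have "card \<dots> = (\<Sum>c\<in>K. card {x \<in> A. f x = c})"
      using fin by (intro card_UN_disjoint) (auto simp: K_def)
    also have "\<dots> = (\<Sum>c\<in>K. m)" using w by (intro sum.cong) (auto simp: K_def)
    also have "\<dots> = m * card K" by simp
    also have "card K = count (image_mset w (mset_set (f ` A))) m"
      using fin by (simp add: count_image_mset K_def) (simp add: vimage_def Int_def conj_commute)
    also have "\<dots> = count_list (m # \<mu>) m" unfolding mset by (simp add: count_mset)
    finally show ?thesis .
  qed
  finally show ?case unfolding T_def z_partition_Cons .
qed

lemma card_rootings: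
  assumes p: "p permutes A" and A: "finite A" and \<mu>: "cycle_type_on p A = mset \<mu>"
  shows "card {R. set R \<subseteq> A \<and> is_rooting p \<mu> R} = z_partition \<mu>"
  unfolding is_rooting_def
proof (rule card_transversal_lists[OF A])
  have perm: "permutation p" using p A permutation_permutes by blast
  show "card c = card {x \<in> A. orbit p x = c}" if "c \<in> orbit p ` A" for c
  proof -
    have "{x \<in> A. orbit p x = c} = c"
      using that orbit_eq_of_mem[OF perm] permutation_self_in_orbit[OF perm] permutes_orbit_subset[OF p] by blast
    then show ?thesis by simp
  qed
  show "image_mset card (mset_set (orbit p ` A)) = mset \<mu>"
    using \<mu> unfolding cycle_type_on_def cycles_on_def .
qed

text \<open>
  A cycle grows by one point when it is merged with a fixed point.
\<close>

lemma cyclic_permutation_exists: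
  assumes "finite A" "A \<noteq> {}" shows "\<exists>p. p permutes A \<and> (\<exists>x\<in>A. orbit p x = A)"
  using assms
proof (induction A rule: finite_ne_induct)
  case (singleton x)
  have "orbit id x = {x}" by (simp add: orbit_eq_singleton_iff)
  then show ?case by (metis permutes_id singletonI)
next
  case (insert a F)
  then obtain p x where p: "p permutes F" "x \<in> F" "orbit p x = F" by blast
  have perm: "permutation p" using p insert permutation_permutes by blast
  have "orbit p a = {a}" using permutes_not_in[OF p(1)] insert by (simp add: orbit_eq_singleton_iff)
  moreover have "orbit (transpose a x \<circ> p) x = orbit p a \<union> orbit p x"
    using insert p permutation_self_in_orbit[OF perm] by (intro orbit_transpose_comp_merged[OF perm]) auto
  moreover have "transpose a x \<circ> p permutes insert a F"
    using p by (intro permutes_compose permutes_swap_id) (auto intro: permutes_subset)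
  ultimately show ?case using p by auto
qed

lemma rooted_permutation_exists:
  assumes "finite A" "card A = sum_list \<mu>" "\<forall>m\<in>set \<mu>. 0 < m"
  shows "\<exists>p R. p permutes A \<and> set R \<subseteq> A \<and> is_rooting p \<mu> R"
  using assms
proof (induction \<mu> arbitrary: A)
  case Nil then show ?case by (intro exI[of _ id] exI[of _ "[]"]) (auto simp: is_rooting_def)
next
  case (Cons m \<mu>)
  obtain C where C: "C \<subseteq> A" "card C = m"
    using Cons.prems obtain_subset_with_card_n[of m A] by auto
  have fin: "finite C" using C Cons.prems finite_subset by blast
  have "C \<noteq> {}" using C Cons.prems by auto
  then obtain p x where p: "p permutes C" "x \<in> C" "orbit p x = C"
    using cyclic_permutation_exists[OF fin] by blast
  obtain q R where q: "q permutes A - C" "set R \<subseteq> A - C" "is_rooting q \<mu> R"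
    using Cons.IH[of "A - C"] Cons.prems C by (auto simp: card_Diff_subset fin)
  let ?s = "p \<circ> q"
  have s: "?s permutes A"
    by (intro permutes_compose) (use p q C in \<open>auto intro: permutes_subset\<close>)
  have "orbit p x = orbit ?s x"
    by (rule orbit_cong0[where A = C])
      (use p permutes_in_image[OF p(1)] permutes_not_in[OF q(1)] in auto)
  then have 1: "orbit ?s x = C" using p by simp
  have 2: "orbit ?s y = orbit q y" if "y \<in> A - C" for y
  proof (rule sym, rule orbit_cong0[where A = "A - C"])
    show "q \<in> (A - C) \<rightarrow> (A - C)" using permutes_in_image[OF q(1)] by blast
    show "q z = ?s z" if "z \<in> A - C" for z
    proof -
      have "q z \<in> A - C" using permutes_in_image[OF q(1)] that by blast
      then show ?thesis using permutes_not_in[OF p(1)] by simp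
    qed
  qed (rule that)
  have map2: "map (orbit ?s) R = map (orbit q) R" using 2 q by (intro map_cong) auto
  have "map (\<lambda>r. card (orbit ?s r)) R = map (\<lambda>r. card (orbit q r)) R"
    using 2 q(2) by (intro map_cong refl arg_cong[where f = card]) auto
  then have map3: "map (\<lambda>r. card (orbit ?s r)) R = \<mu>"
    using q(3) unfolding is_rooting_def by simp
  have "C \<noteq> orbit q y" if "y \<in> set R" for y
    using permutes_orbit_subset[OF q(1), of y] that q(2) \<open>C \<noteq> {}\<close> by auto
  then have "orbit ?s x \<notin> set (map (orbit ?s) R)" unfolding map2 1 by auto
  then have "is_rooting ?s (m # \<mu>) (x # R)"
    using q(3) map2 map3 1 C(2) unfolding is_rooting_def by (simp only: list.map distinct.simps) simp
  moreover have "set (x # R) \<subseteq> A" using q(2) C p(2) by auto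
  ultimately show ?case using s by blast
qed

text \<open>
  Conjugation lets the symmetric group act simply transitively on the pairs of a permutation and a
  list rooting it, since a permutation commuting with \<open>p\<close> is determined by the images of the roots.
  There are therefore as many pairs as permutations, and every permutation of type \<open>\<mu>\<close> occurs in
  \<open>z(\<mu>)\<close> of them.
\<close>

lemma card_permutations_of_cycle_type:
  assumes A: "finite A" "card A = sum_list \<mu>" and pos: "\<forall>m\<in>set \<mu>. 0 < m"
  shows "card {p. p permutes A \<and> cycle_type_on p A = mset \<mu>} * z_partition \<mu> = fact (card A)"
proof -
  obtain p R where p: "p permutes A" "set R \<subseteq> A" "is_rooting p \<mu> R"
    using rooted_permutation_exists[OF A pos] by blast
  have perm: "permutation p" using p A permutation_permutes by blast
  have cover: "(\<Union>r\<in>set R. orbit p r) = A" using rooting_covers p A by blast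
  let ?K = "{q. q permutes A \<and> cycle_type_on q A = mset \<mu>}"
  let ?P = "SIGMA q:?K. {S. set S \<subseteq> A \<and> is_rooting q \<mu> S}"
  let ?h = "\<lambda>\<phi>. (\<phi> \<circ> p \<circ> inv \<phi>, map \<phi> R)"
  have "bij_betw ?h {\<phi>. \<phi> permutes A} ?P"
  proof (rule bij_betwI')
    fix \<phi> \<psi> assume "\<phi> \<in> {\<phi>. \<phi> permutes A}" "\<psi> \<in> {\<phi>. \<phi> permutes A}"
    then have \<phi>: "\<phi> permutes A" and \<psi>: "\<psi> permutes A" by auto
    have "\<phi> = \<psi>" if eq: "?h \<phi> = ?h \<psi>"
    proof
      fix x
      show "\<phi> x = \<psi> x"
      proof (cases "x \<in> A")
        case True
        then obtain r where r: "r \<in> set R" "x \<in> orbit p r" using cover by auto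
        define q where "q = \<phi> \<circ> p \<circ> inv \<phi>"
        have "q = \<psi> \<circ> p \<circ> inv \<psi>" using eq by (simp only: q_def prod.inject)
        then have comm: "\<phi> (p y) = q (\<phi> y)" "\<psi> (p y) = q (\<psi> y)" for y
          using permutes_inverses(2)[OF \<phi>, of y] permutes_inverses(2)[OF \<psi>, of y]
          unfolding q_def by (metis comp_apply)+
        have "\<phi> r = \<psi> r" using eq r(1) by simp
        then show ?thesis
          using r(2) by (rule intertwiners_agree_on_orbit[OF permutation_self_in_orbit[OF perm]]) (rule comm)+
      next
        case False then show ?thesis using permutes_not_in \<phi> \<psi> by metis
      qed
    qed
    then show "?h \<phi> = ?h \<psi> \<longleftrightarrow> \<phi> = \<psi>" by auto
  next
    fix \<phi> assume "\<phi> \<in> {\<phi>. \<phi> permutes A}"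
    then have \<phi>: "\<phi> permutes A" by simp
    define q where "q = \<phi> \<circ> p \<circ> inv \<phi>"
    have q: "q permutes A" unfolding q_def using \<phi> p by (intro permutes_compose permutes_inv)
    have orb: "orbit q (\<phi> x) = \<phi> ` orbit p x" for x
      by (rule orbit_inverse[symmetric])
        (use permutation_self_in_orbit[OF perm] permutes_inverses[OF \<phi>] in \<open>auto simp: q_def\<close>)
    have inj: "inj \<phi>" using \<phi> by (rule permutes_inj)
    have "is_rooting q \<mu> (map \<phi> R)"
      using p(3) unfolding is_rooting_def
      by (auto simp: orb o_def distinct_map inj_on_def card_image inj_image_eq_iff[OF inj]
            card_image[OF inj_on_subset[OF inj subset_UNIV]])
    moreover have "set (map \<phi> R) \<subseteq> A" using p(2) permutes_in_image[OF \<phi>] by auto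
    ultimately show "?h \<phi> \<in> ?P" unfolding q_def[symmetric] using q cycle_type_on_rooting[OF q A, of "map \<phi> R"] by auto
  next
    fix y assume "y \<in> ?P"
    then obtain q S where y: "y = (q, S)" "q permutes A" "set S \<subseteq> A" "is_rooting q \<mu> S" by auto
    have permq: "permutation q" using y A permutation_permutes by blast
    obtain \<beta> where \<beta>: "bij_betw \<beta> A A" "\<forall>x\<in>A. \<beta> (p x) = q (\<beta> x)" "map \<beta> R = S"
      using rooted_intertwiner_exists[OF perm permq p(3) y(4)]
      unfolding cover rooting_covers[OF y(2) A y(3,4)] by blast
    define \<phi> where "\<phi> = (\<lambda>x. if x \<in> A then \<beta> x else x)"
    have \<phi>: "\<phi> permutes A"
      by (rule bij_imp_permutes) (use \<beta>(1) in \<open>auto simp: \<phi>_def cong: bij_betw_cong\<close>)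
    have comm: "\<phi> (p x) = q (\<phi> x)" for x
      using \<beta>(2) permutes_in_image[OF p(1)] permutes_not_in[OF p(1)] permutes_not_in[OF y(2)]
      by (auto simp: \<phi>_def)
    have "\<phi> \<circ> p \<circ> inv \<phi> = q" by (simp add: fun_eq_iff comm permutes_inverses[OF \<phi>])
    moreover have "map \<phi> R = map \<beta> R" using p(2) by (intro map_cong) (auto simp: \<phi>_def)
    ultimately have "y = ?h \<phi>" using y(1) \<beta>(3) by simp
    then show "\<exists>\<phi>\<in>{\<phi>. \<phi> permutes A}. y = ?h \<phi>" using \<phi> by blast
  qed
  then have "card ?P = card {\<phi>. \<phi> permutes A}" by (rule bij_betw_same_card[symmetric])
  also have "\<dots> = fact (card A)" using card_permutations[OF refl A(1)] .
  also have "card ?P = (\<Sum>q\<in>?K. card {S. set S \<subseteq> A \<and> is_rooting q \<mu> S})"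
  proof (rule card_SigmaI)
    show "finite ?K" using finite_permutations[OF A(1)] by simp
    have "{S. set S \<subseteq> A \<and> is_rooting q \<mu> S} \<subseteq> {S. set S \<subseteq> A \<and> length S = length \<mu>}" for q
      by (auto simp: is_rooting_def)
    then show "\<forall>q\<in>?K. finite {S. set S \<subseteq> A \<and> is_rooting q \<mu> S}"
      using finite_lists_length_eq[OF A(1)] finite_subset by blast
  qed
  also have "\<dots> = (\<Sum>q\<in>?K. z_partition \<mu>)"
    using card_rootings[OF _ A(1)] by (intro sum.cong) auto
  finally show ?thesis by simp
qed

section \<open>Invariance under equivalence of maps\<close>

lemma is_map_permutation:
  assumes "is_map M"
  shows "permutation (sigma0 M)" "permutation (sigma1 M)" "permutation (sigma2 M)"
  using assms permutation_permutes unfolding is_map_def by blast+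

lemma orbit_conjugate:
  assumes p: "p permutes E" "finite E" and e: "e \<in> E" and comm: "\<forall>e\<in>E. q (\<phi> e) = \<phi> (p e)"
  shows "orbit q (\<phi> e) = \<phi> ` orbit p e"
proof (rule orbit_inverse[symmetric])
  show "e \<in> orbit p e" using permutation_self_in_orbit p permutation_permutes by metis
  show "q (\<phi> x) = \<phi> (p x)" if "x \<in> orbit p e" for x
    using that permutes_orbit_subset[OF p(1) e] comm by blast
qed

lemma cycles_on_conjugate:
  assumes "p permutes E" "finite E" "\<forall>e\<in>E. q (\<phi> e) = \<phi> (p e)"
  shows "cycles_on q (\<phi> ` E) = (`) \<phi> ` cycles_on p E"
  using orbit_conjugate[OF assms(1,2) _ assms(3)] unfolding cycles_on_def image_image
  by (intro image_cong) auto

lemma cycles_on_subset_Pow: "p permutes E \<Longrightarrow> cycles_on p E \<subseteq> Pow E"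
  using permutes_orbit_subset unfolding cycles_on_def by fast

context
  fixes M :: "'e map_data" and N :: "'f map_data" and \<phi>
  assumes M: "is_map M" and iso: "map_iso \<phi> M N"
begin

lemma iso_inj: "inj_on \<phi> (oedges M)" and iso_image: "oedges N = \<phi> ` oedges M"
  using iso unfolding map_iso_def bij_betw_def by auto

lemma iso_inj_image: "inj_on ((`) \<phi>) (Pow (oedges M))"
  using iso_inj by (rule inj_on_image_Pow)

lemma iso_vertices: "vertices N = (`) \<phi> ` vertices M"
  and iso_edges: "edges N = (`) \<phi> ` edges M"
  and iso_faces: "faces N = (`) \<phi> ` faces M"
proof -
  have E: "finite (oedges M)" and
    p: "sigma0 M permutes oedges M" "sigma1 M permutes oedges M" "sigma2 M permutes oedges M" and
    comm: "\<forall>e\<in>oedges M. sigma0 N (\<phi> e) = \<phi> (sigma0 M e)"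
      "\<forall>e\<in>oedges M. sigma1 N (\<phi> e) = \<phi> (sigma1 M e)"
      "\<forall>e\<in>oedges M. sigma2 N (\<phi> e) = \<phi> (sigma2 M e)"
    using M iso unfolding is_map_def map_iso_def by auto
  show "vertices N = (`) \<phi> ` vertices M" unfolding vertices_def iso_image
    by (rule cycles_on_conjugate[OF p(1) E comm(1)])
  show "edges N = (`) \<phi> ` edges M" unfolding edges_def iso_image
    by (rule cycles_on_conjugate[OF p(2) E comm(2)])
  show "faces N = (`) \<phi> ` faces M" unfolding faces_def iso_image
    by (rule cycles_on_conjugate[OF p(3) E comm(3)])
qed

lemma sets_of_oedges:
  "vertices M \<subseteq> Pow (oedges M)" "edges M \<subseteq> Pow (oedges M)" "faces M \<subseteq> Pow (oedges M)"
  using M cycles_on_subset_Pow unfolding vertices_def edges_def faces_def is_map_def by blast+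

lemma iso_boundary_faces: "boundary_faces N = map ((`) \<phi>) (boundary_faces M)"
proof -
  have "orbit (sigma2 N) (\<phi> r) = \<phi> ` orbit (sigma2 M) r" if "r \<in> set (roots M)" for r
    using that M iso unfolding is_map_def map_iso_def
    by (intro orbit_conjugate[of _ "oedges M"]) auto
  then show ?thesis using iso unfolding boundary_faces_def map_iso_def by auto
qed

lemma boundary_faces_subset: "set (boundary_faces M) \<subseteq> faces M"
  using M unfolding boundary_faces_def faces_def cycles_on_def is_map_def by auto

lemma iso_boundary_edges: "boundary_edges N = \<phi> ` boundary_edges M"
  unfolding boundary_edges_def iso_boundary_faces by auto

lemma iso_internal_faces: "internal_faces N = (`) \<phi> ` internal_faces M"
proof -
  have "(`) \<phi> ` (faces M - set (boundary_faces M)) = (`) \<phi> ` faces M - (`) \<phi> ` set (boundary_faces M)"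
    by (rule inj_on_image_set_diff[OF iso_inj_image]) (use sets_of_oedges boundary_faces_subset in auto)
  then show ?thesis unfolding internal_faces_def iso_faces iso_boundary_faces by simp
qed

lemma iso_card_image: "\<F> \<subseteq> Pow (oedges M) \<Longrightarrow> card ((`) \<phi> ` \<F>) = card \<F>"
  using iso_inj_image by (intro card_image) (rule inj_on_subset)

lemma iso_card: "F \<subseteq> oedges M \<Longrightarrow> card (\<phi> ` F) = card F"
  using iso_inj by (intro card_image) (rule inj_on_subset)

lemma iso_num_internal: "num_internal N k = num_internal M k"
proof -
  have sub: "internal_faces M \<subseteq> Pow (oedges M)" using sets_of_oedges by (auto simp: internal_faces_def)
  then have "{F \<in> internal_faces N. card F = k} = (`) \<phi> ` {F \<in> internal_faces M. card F = k}"
    unfolding iso_internal_faces using iso_card by auto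
  moreover have "{F \<in> internal_faces M. card F = k} \<subseteq> Pow (oedges M)" using sub by auto
  ultimately show ?thesis unfolding num_internal_def by (simp only: iso_card_image)
qed

lemma iso_euler_char: "euler_char N = euler_char M"
proof -
  have "internal_faces M \<subseteq> Pow (oedges M)" using sets_of_oedges by (auto simp: internal_faces_def)
  then show ?thesis unfolding euler_char_def iso_vertices iso_edges iso_internal_faces
    by (simp only: iso_card_image sets_of_oedges)
qed

lemma boundary_edges_subset: "boundary_edges M \<subseteq> oedges M"
  using boundary_faces_subset sets_of_oedges unfolding boundary_edges_def by auto

lemma iso_fully_simple: "fully_simple N \<longleftrightarrow> fully_simple M"
proof -
  have "card (\<phi> ` v \<inter> boundary_edges N) = card (v \<inter> boundary_edges M)" if "v \<in> vertices M" for v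
  proof -
    have v: "v \<subseteq> oedges M" using that sets_of_oedges by auto
    have "\<phi> ` v \<inter> boundary_edges N = \<phi> ` (v \<inter> boundary_edges M)"
      unfolding iso_boundary_edges using inj_on_image_Int[OF iso_inj v boundary_edges_subset] by simp
    then show ?thesis using iso_card[of "v \<inter> boundary_edges M"] v by auto
  qed
  then show ?thesis unfolding fully_simple_def iso_vertices by auto
qed

text \<open>
  Conjugation by \<open>\<phi>\<close> embeds the automorphisms of \<open>M\<close> into those of \<open>N\<close>. The opposite inequality comes
  from the inverse equivalence.
\<close>

lemma iso_card_automorphisms_le:
  assumes "finite (oedges N)" shows "card (automorphisms M) \<le> card (automorphisms N)"
proof (rule card_inj_on_le)
  let ?h = "map_permutation (oedges M) \<phi>"
  have bij: "bij_betw \<phi> (oedges M) (oedges N)" using iso unfolding map_iso_def by simp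
  show "inj_on ?h (automorphisms M)"
  proof (rule inj_onI)
    fix \<alpha> \<beta> assume ab: "\<alpha> \<in> automorphisms M" "\<beta> \<in> automorphisms M" "?h \<alpha> = ?h \<beta>"
    have "\<alpha> e = \<beta> e" if e: "e \<in> oedges M" for e
    proof -
      have "\<phi> (\<alpha> e) = \<phi> (\<beta> e)"
        using arg_cong[OF ab(3), of "\<lambda>f. f (\<phi> e)"] map_permutation_apply[OF iso_inj e] by simp
      moreover have "\<alpha> e \<in> oedges M" "\<beta> e \<in> oedges M"
        using ab e unfolding automorphisms_def by (auto simp: permutes_in_image)
      ultimately show ?thesis using iso_inj by (simp add: inj_on_def)
    qed
    moreover have "\<alpha> e = \<beta> e" if "e \<notin> oedges M" for e
      using ab that permutes_not_in[of \<alpha> "oedges M" e] permutes_not_in[of \<beta> "oedges M" e]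
      unfolding automorphisms_def by simp
    ultimately show "\<alpha> = \<beta>" by auto
  qed
  show "?h ` automorphisms M \<subseteq> automorphisms N"
  proof
    fix \<gamma> assume "\<gamma> \<in> ?h ` automorphisms M"
    then obtain \<alpha> where \<alpha>: "\<gamma> = ?h \<alpha>" "\<alpha> permutes oedges M" "map_iso \<alpha> M M"
      unfolding automorphisms_def by auto
    have \<gamma>: "\<gamma> permutes oedges N" unfolding \<alpha>(1) by (rule map_permutation_permutes[OF bij \<alpha>(2)])
    have app: "\<gamma> (\<phi> e) = \<phi> (\<alpha> e)" if "e \<in> oedges M" for e
      unfolding \<alpha>(1) by (rule map_permutation_apply[OF iso_inj that])
    have in_M: "\<alpha> e \<in> oedges M" "sigma0 M e \<in> oedges M" "sigma1 M e \<in> oedges M" "sigma2 M e \<in> oedges M"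
      if "e \<in> oedges M" for e
      using that M permutes_in_image[OF \<alpha>(2)] unfolding is_map_def by (simp_all add: permutes_in_image)
    have "map \<gamma> (map \<phi> (roots M)) = map \<phi> (map \<alpha> (roots M))"
      using M app unfolding is_map_def by auto
    then have "roots N = map \<gamma> (roots N)" using iso \<alpha>(3) unfolding map_iso_def by simp
    then have "map_iso \<gamma> N N"
      using iso \<alpha>(3) permutes_imp_bij[OF \<gamma>] unfolding map_iso_def iso_image
      by (simp add: app in_M)
    then show "\<gamma> \<in> automorphisms N" unfolding automorphisms_def using \<gamma> by simp
  qed
  have "automorphisms N \<subseteq> {\<alpha>. \<alpha> permutes oedges N}" unfolding automorphisms_def by auto
  then show "finite (automorphisms N)" using finite_permutations[OF assms] finite_subset by blast
qed

end

lemma map_equiv_sym: "(M, N) \<in> map_equiv \<Longrightarrow> (N, M) \<in> map_equiv"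
  using equiv_map_equiv by (meson equivE symE)

lemma map_equiv_card_automorphisms:
  assumes "(M, N) \<in> map_equiv" shows "card (automorphisms M) = card (automorphisms N)"
proof (rule antisym)
  show "card (automorphisms M) \<le> card (automorphisms N)"
    using assms iso_card_automorphisms_le unfolding map_equiv_def is_map_def by blast
  show "card (automorphisms N) \<le> card (automorphisms M)"
    using map_equiv_sym[OF assms] iso_card_automorphisms_le unfolding map_equiv_def is_map_def by blast
qed

lemma map_equiv_weight:
  assumes "(M, N) \<in> map_equiv" shows "map_weight M = map_weight N"
proof -
  have "euler_char N = euler_char M" using assms iso_euler_char unfolding map_equiv_def by blast
  then show ?thesis unfolding map_weight_def using map_equiv_card_automorphisms[OF assms] by simp
qed

section \<open>Relabelling the oriented edges\<close>

definition relabel :: "('e \<Rightarrow> 'f) \<Rightarrow> 'e map_data \<Rightarrow> 'f map_data" where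
  "relabel \<phi> M = \<lparr>oedges = \<phi> ` oedges M,
    sigma0 = map_permutation (oedges M) \<phi> (sigma0 M),
    sigma1 = map_permutation (oedges M) \<phi> (sigma1 M),
    sigma2 = map_permutation (oedges M) \<phi> (sigma2 M),
    roots = map \<phi> (roots M)\<rparr>"

lemma map_iso_relabel:
  assumes "inj_on \<phi> (oedges M)" shows "map_iso \<phi> M (relabel \<phi> M)"
  using assms unfolding map_iso_def relabel_def by (simp add: map_permutation_apply bij_betw_def)

lemma is_map_relabel:
  assumes M: "is_map M" and inj: "inj_on \<phi> (oedges M)" shows "is_map (relabel \<phi> M)"
proof -
  let ?h = "map_permutation (oedges M) \<phi>"
  have bij: "bij_betw \<phi> (oedges M) (\<phi> ` oedges M)" using inj by (simp add: bij_betw_def)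
  have p: "sigma0 M permutes oedges M" "sigma1 M permutes oedges M" "sigma2 M permutes oedges M"
    using M unfolding is_map_def by auto
  have "?h (sigma0 M) \<circ> ?h (sigma1 M) \<circ> ?h (sigma2 M) = ?h (sigma0 M \<circ> sigma1 M \<circ> sigma2 M)"
    by (simp only: map_permutation_compose'[OF inj p(2)] map_permutation_compose'[OF inj p(3)])
  also have "\<dots> = id" using M map_permutation_id'[OF inj] unfolding is_map_def by simp
  finally have comp: "?h (sigma0 M) \<circ> ?h (sigma1 M) \<circ> ?h (sigma2 M) = id" .
  have inv: "?h (sigma1 M) (\<phi> e) \<noteq> \<phi> e \<and> ?h (sigma1 M) (?h (sigma1 M) (\<phi> e)) = \<phi> e"
    if e: "e \<in> oedges M" for e
  proof -
    have e': "sigma1 M e \<in> oedges M" using e permutes_in_image[OF p(2)] by simp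
    have "sigma1 M e \<noteq> e" "sigma1 M (sigma1 M e) = e" using M e unfolding is_map_def by auto
    then show ?thesis
      using e e' inj by (simp add: map_permutation_apply[OF inj] inj_on_eq_iff)
  qed
  have orbits: "map (orbit (?h (sigma2 M))) (map \<phi> (roots M)) = map ((`) \<phi>) (map (orbit (sigma2 M)) (roots M))"
    using iso_boundary_faces[OF M map_iso_relabel[OF inj]]
    unfolding boundary_faces_def relabel_def by simp
  have "distinct (map ((`) \<phi>) (map (orbit (sigma2 M)) (roots M)))"
  proof -
    have "set (map (orbit (sigma2 M)) (roots M)) \<subseteq> Pow (oedges M)"
      using M permutes_orbit_subset[OF p(3)] unfolding is_map_def by fastforce
    then show ?thesis
      using M inj_on_subset[OF inj_on_image_Pow[OF inj]] unfolding is_map_def distinct_map[of "(`) \<phi>"]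
      by blast
  qed
  then have "distinct (map (orbit (?h (sigma2 M))) (map \<phi> (roots M)))" unfolding orbits .
  then show ?thesis
    using M comp inv map_permutation_permutes[OF bij] unfolding is_map_def relabel_def by auto
qed

lemma map_equiv_relabel:
  assumes "is_map M" "inj_on \<phi> (oedges M)" shows "(M, relabel \<phi> M) \<in> map_equiv"
  unfolding map_equiv_def using assms is_map_relabel map_iso_relabel by blast

lemma map_iso_determines:
  fixes N N' :: "nat map_data"
  assumes "map_iso \<phi> M N" "map_iso \<phi> M N'" "is_map N" "is_map N'"
  shows "N = N'"
proof (rule map_data.equality)
  have E: "oedges N = \<phi> ` oedges M" "oedges N' = \<phi> ` oedges M"
    using assms unfolding map_iso_def bij_betw_def by auto
  then show "oedges N = oedges N'" by simp
  have ext: "p = q" if "p permutes \<phi> ` oedges M" "q permutes \<phi> ` oedges M"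
    "\<forall>e\<in>oedges M. p (\<phi> e) = q (\<phi> e)" for p q
  proof
    fix x show "p x = q x"
    proof (cases "x \<in> \<phi> ` oedges M")
      case True then show ?thesis using that(3) by auto
    next
      case False then show ?thesis using that(1,2) permutes_not_in by metis
    qed
  qed
  show "sigma0 N = sigma0 N'" "sigma1 N = sigma1 N'" "sigma2 N = sigma2 N'"
    using assms E unfolding map_iso_def is_map_def by (auto intro!: ext)
  show "roots N = roots N'" using assms unfolding map_iso_def by simp
qed simp

section \<open>Maps with a labelled boundary\<close>

text \<open>
  The number of oriented edges adjacent to internal faces of the degrees listed by the monomial \<open>m\<close>.
\<close>

definition total_degree :: "(nat \<Rightarrow>\<^sub>0 nat) \<Rightarrow> nat" where
  "total_degree m = (\<Sum>k\<in>Poly_Mapping.keys m. k * Poly_Mapping.lookup m k)"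

lemma sum_card_eq_total_degree:
  assumes "finite \<F>" and "\<And>k. card {F \<in> \<F>. card F = k} = Poly_Mapping.lookup m k"
  shows "(\<Sum>F\<in>\<F>. card F) = total_degree m"
proof -
  have "card ` \<F> \<subseteq> Poly_Mapping.keys m"
  proof
    fix k assume "k \<in> card ` \<F>"
    then have "{F \<in> \<F>. card F = k} \<noteq> {}" by auto
    then have "card {F \<in> \<F>. card F = k} \<noteq> 0" using assms(1) by simp
    then show "k \<in> Poly_Mapping.keys m" using assms(2) by (simp add: in_keys_iff)
  qed
  then have "(\<Sum>F\<in>\<F>. card F) = (\<Sum>k\<in>Poly_Mapping.keys m. \<Sum>F\<in>{F \<in> \<F>. card F = k}. card F)"
    using assms(1) by (intro sum.group[symmetric]) auto
  also have "\<dots> = (\<Sum>k\<in>Poly_Mapping.keys m. k * card {F \<in> \<F>. card F = k})"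
    by (intro sum.cong) (auto simp: sum_constant mult.commute)
  finally show ?thesis using assms(2) unfolding total_degree_def by simp
qed

lemma sum_card_cycles:
  assumes "p permutes E" "finite E"
  shows "(\<Sum>C\<in>cycles_on p E. card C) = card E"
proof -
  have perm: "permutation p" using assms permutation_permutes by blast
  have "E = \<Union>(cycles_on p E)"
    using permutes_orbit_subset[OF assms(1)] permutation_self_in_orbit[OF perm]
    unfolding cycles_on_def by auto
  moreover have "card (\<Union>(cycles_on p E)) = (\<Sum>C\<in>cycles_on p E. card C)"
    by (rule card_Union_disjoint)
      (auto simp: cycles_on_def pairwise_def disjnt_def finite_orbit_permutation[OF perm]
        dest: orbit_eq_of_mem[OF perm])
  ultimately show ?thesis by simp
qed

definition num_oedges :: "nat \<Rightarrow> (nat \<Rightarrow>\<^sub>0 nat) \<Rightarrow> nat" where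
  "num_oedges d m = d + total_degree m"

text \<open>
  A boundary of type \<open>\<mu>\<close> prescribed on \<open>{1..d}\<close>, with root \<open>i\<close> on a cycle of length \<open>\<mu>\<^sub>i\<close>. Since the
  \<open>\<mu>\<^sub>i\<close> add up to \<open>d\<close>, every boundary edge is reached from a root.
\<close>

locale rooted_boundary =
  fixes d :: nat and \<mu> :: "nat list" and \<rho> :: "nat \<Rightarrow> nat" and R :: "nat list"
    and m :: "nat \<Rightarrow>\<^sub>0 nat"
  assumes permutes_\<rho>: "\<rho> permutes {1..d}" and roots_subset: "set R \<subseteq> {1..d}"
    and rooting: "is_rooting \<rho> \<mu> R" and sum_\<mu>: "sum_list \<mu> = d"
begin

abbreviation N :: nat where "N \<equiv> num_oedges d m"

definition labelled_maps :: "nat map_data set" where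
  "labelled_maps = {M. is_map M \<and> oedges M = {1..N} \<and> roots M = R \<and>
    (\<forall>b\<in>{1..d}. sigma2 M b = \<rho> b) \<and> (\<forall>k. num_internal M k = Poly_Mapping.lookup m k)}"

lemma finite_labelled_maps: "finite labelled_maps"
proof (rule finite_subset)
  let ?P = "{p. p permutes {1..N}}"
  let ?mk = "\<lambda>(a, b, c). \<lparr>oedges = {1..N}, sigma0 = a, sigma1 = b, sigma2 = c, roots = R\<rparr>"
  show "labelled_maps \<subseteq> ?mk ` (?P \<times> ?P \<times> ?P)"
  proof
    fix M assume M: "M \<in> labelled_maps"
    then have "M = ?mk (sigma0 M, sigma1 M, sigma2 M)" by (simp add: labelled_maps_def)
    moreover have "(sigma0 M, sigma1 M, sigma2 M) \<in> ?P \<times> ?P \<times> ?P"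
    proof -
      have E: "oedges M = {1..N}" using M by (simp add: labelled_maps_def)
      have "sigma0 M permutes oedges M" "sigma1 M permutes oedges M" "sigma2 M permutes oedges M"
        using M unfolding labelled_maps_def is_map_def by blast+
      then show ?thesis unfolding E by simp
    qed
    ultimately show "M \<in> ?mk ` (?P \<times> ?P \<times> ?P)" by (rule image_eqI)
  qed
qed (simp add: finite_permutations)

lemma cover: "(\<Union>r\<in>set R. orbit \<rho> r) = {1..d}"
  using rooting_covers[OF permutes_\<rho> _ _ roots_subset rooting] sum_\<mu> by simp

lemma orbit_boundary:
  assumes "\<forall>b\<in>{1..d}. p b = \<rho> b" "b \<in> {1..d}" shows "orbit p b = orbit \<rho> b"
proof (rule sym, rule orbit_cong0[where A = "{1..d}"])
  show "\<rho> \<in> {1..d} \<rightarrow> {1..d}" using permutes_in_image[OF permutes_\<rho>] by blast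
qed (use assms in auto)

lemma labelled_boundary_faces:
  assumes "roots M = R" "\<forall>b\<in>{1..d}. sigma2 M b = \<rho> b"
  shows "boundary_faces M = map (orbit \<rho>) R"
  unfolding boundary_faces_def assms(1)
  by (rule map_cong[OF refl]) (use orbit_boundary[OF assms(2)] roots_subset in auto)

lemma labelled_boundary_edges:
  assumes "roots M = R" "\<forall>b\<in>{1..d}. sigma2 M b = \<rho> b"
  shows "boundary_edges M = {1..d}"
  unfolding boundary_edges_def labelled_boundary_faces[OF assms] using cover by simp

lemma labelled_maps_subset: "labelled_maps \<subseteq> maps_with \<mu> m"
proof
  fix M assume "M \<in> labelled_maps"
  then show "M \<in> maps_with \<mu> m"
    using labelled_boundary_faces[of M] rooting unfolding labelled_maps_def maps_with_def is_rooting_def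
    by (auto simp: comp_def)
qed

lemma card_boundary_edges:
  assumes M: "is_map M" and deg: "map card (boundary_faces M) = \<mu>"
  shows "card (boundary_edges M) = d"
proof -
  have perm: "permutation (sigma2 M)" using is_map_permutation[OF M] by simp
  have "card (boundary_edges M) = (\<Sum>C\<in>set (boundary_faces M). card C)"
    unfolding boundary_edges_def
    by (rule card_Union_disjoint)
      (auto simp: boundary_faces_def pairwise_def disjnt_def finite_orbit_permutation[OF perm]
        dest: orbit_eq_of_mem[OF perm])
  also have "\<dots> = sum_list (map card (boundary_faces M))"
    using M by (intro sum.distinct_set_conv_list) (simp add: boundary_faces_def is_map_def)
  finally show ?thesis using deg sum_\<mu> by simp
qed

lemma card_oedges:
  assumes "M \<in> maps_with \<mu> m" shows "card (oedges M) = N"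
proof -
  have M: "is_map M" "map card (boundary_faces M) = \<mu>"
    "\<And>k. num_internal M k = Poly_Mapping.lookup m k"
    using assms unfolding maps_with_def by auto
  have perm: "permutation (sigma2 M)" using is_map_permutation[OF M(1)] by simp
  have s2: "sigma2 M permutes oedges M" "finite (oedges M)" using M(1) unfolding is_map_def by auto
  have fin: "finite (faces M)" using s2 by (simp add: faces_def cycles_on_def)
  have sub: "set (boundary_faces M) \<subseteq> faces M"
    using M(1) unfolding boundary_faces_def faces_def cycles_on_def is_map_def by auto
  have "card (oedges M) = (\<Sum>C\<in>faces M. card C)"
    unfolding faces_def using sum_card_cycles[OF s2] by simp
  also have "\<dots> = (\<Sum>C\<in>set (boundary_faces M). card C) + (\<Sum>C\<in>internal_faces M. card C)"
    unfolding internal_faces_def using fin sub by (subst sum.subset_diff[OF sub fin]) simp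
  also have "(\<Sum>C\<in>set (boundary_faces M). card C) = sum_list (map card (boundary_faces M))"
    using M by (intro sum.distinct_set_conv_list) (simp add: boundary_faces_def is_map_def)
  also have "\<dots> = d" using M(2) sum_\<mu> by simp
  also have "(\<Sum>C\<in>internal_faces M. card C) = total_degree m"
    using M(3) fin unfolding num_internal_def
    by (intro sum_card_eq_total_degree) (auto simp: internal_faces_def)
  finally show ?thesis unfolding num_oedges_def .
qed

text \<open>
  The boundary edges of \<open>M\<close> are numbered by following the faces from the roots in step with \<open>\<rho>\<close>, and
  the remaining oriented edges are numbered arbitrarily; there are exactly as many of these as labels
  left over.
\<close>

lemma labelled_representative_exists:
  assumes M: "M \<in> maps_with \<mu> m" shows "\<exists>M'\<in>labelled_maps. (M, M') \<in> map_equiv"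
proof -
  have map: "is_map M" and deg: "map card (boundary_faces M) = \<mu>"
    and int: "\<And>k. num_internal M k = Poly_Mapping.lookup m k"
    using M unfolding maps_with_def by auto
  have s2: "sigma2 M permutes oedges M" "finite (oedges M)" "set (roots M) \<subseteq> oedges M"
    using map unfolding is_map_def by auto
  have perm: "permutation (sigma2 M)" using is_map_permutation[OF map] by simp
  have perm\<rho>: "permutation \<rho>" using permutes_\<rho> permutation_permutes by blast
  have "is_rooting (sigma2 M) \<mu> (roots M)"
    using map deg unfolding is_rooting_def boundary_faces_def is_map_def by (auto simp: comp_def)
  moreover have bd: "boundary_edges M = (\<Union>r\<in>set (roots M). orbit (sigma2 M) r)"
    unfolding boundary_edges_def boundary_faces_def by simp
  ultimately obtain \<beta> where \<beta>: "bij_betw \<beta> (boundary_edges M) {1..d}"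
    "\<forall>x\<in>boundary_edges M. \<beta> (sigma2 M x) = \<rho> (\<beta> x)" "map \<beta> (roots M) = R"
    using rooted_intertwiner_exists[OF perm perm\<rho> _ rooting, of "roots M"] unfolding cover bd by blast
  have sub: "boundary_edges M \<subseteq> oedges M"
    unfolding bd using permutes_orbit_subset[OF s2(1)] s2(3) by blast
  have "card (oedges M - boundary_edges M) = card {d<..N}"
    using card_Diff_subset[OF finite_subset[OF sub s2(2)] sub] card_oedges[OF M]
      card_boundary_edges[OF map deg] by simp
  then obtain \<gamma> where \<gamma>: "bij_betw \<gamma> (oedges M - boundary_edges M) {d<..N}"
    using finite_same_card_bij s2(2) by blast
  define \<phi> where "\<phi> = (\<lambda>x. if x \<in> boundary_edges M then \<beta> x else \<gamma> x)"
  have "bij_betw \<phi> (boundary_edges M \<union> (oedges M - boundary_edges M)) ({1..d} \<union> {d<..N})"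
  proof (rule bij_betw_combine)
    show "bij_betw \<phi> (boundary_edges M) {1..d}"
      using \<beta>(1) by (rule bij_betw_cong[THEN iffD1, rotated]) (simp add: \<phi>_def)
    show "bij_betw \<phi> (oedges M - boundary_edges M) {d<..N}"
      using \<gamma> by (rule bij_betw_cong[THEN iffD1, rotated]) (simp add: \<phi>_def)
  qed auto
  moreover have "boundary_edges M \<union> (oedges M - boundary_edges M) = oedges M" using sub by auto
  moreover have "{1..d} \<union> {d<..N} = {1..N}" by (auto simp: num_oedges_def)
  ultimately have \<phi>: "bij_betw \<phi> (oedges M) {1..N}" by simp
  have inj: "inj_on \<phi> (oedges M)" using \<phi> by (rule bij_betw_imp_inj_on)
  define M' where "M' = relabel \<phi> M"
  have equiv: "(M, M') \<in> map_equiv" unfolding M'_def by (rule map_equiv_relabel[OF map inj])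
  have iso: "map_iso \<phi> M M'" unfolding M'_def by (rule map_iso_relabel[OF inj])
  have "oedges M' = {1..N}" using \<phi> by (simp add: M'_def relabel_def bij_betw_def)
  moreover have "roots M' = R"
  proof -
    have "map \<phi> (roots M) = map \<beta> (roots M)"
      by (rule map_cong[OF refl]) (use permutation_self_in_orbit[OF perm] in \<open>auto simp: \<phi>_def bd\<close>)
    then show ?thesis using \<beta>(3) by (simp add: M'_def relabel_def)
  qed
  moreover have "sigma2 M' b = \<rho> b" if "b \<in> {1..d}" for b
  proof -
    have "b \<in> \<beta> ` boundary_edges M" using \<beta>(1) that unfolding bij_betw_def by blast
    then obtain x where x: "x \<in> boundary_edges M" "b = \<beta> x" by blast
    have "sigma2 M x \<in> boundary_edges M" using x(1) unfolding bd by (auto intro: orbit.step)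
    moreover have "sigma2 M' (\<phi> x) = \<phi> (sigma2 M x)" using iso x(1) sub unfolding map_iso_def by auto
    ultimately show ?thesis using x \<beta>(2) by (simp add: \<phi>_def)
  qed
  moreover have "num_internal M' k = Poly_Mapping.lookup m k" for k
    using iso_num_internal[OF map iso] int by simp
  moreover have "is_map M'" using equiv unfolding map_equiv_def by simp
  ultimately have "M' \<in> labelled_maps" unfolding labelled_maps_def by auto
  then show ?thesis using equiv by blast
qed

text \<open>
  An equivalence fixes the roots and commutes with the face permutation, which on both sides is \<open>\<rho>\<close>.
\<close>

lemma iso_fixes_boundary:
  assumes M: "M \<in> labelled_maps" and M': "M' \<in> labelled_maps" and iso: "map_iso \<phi> M M'"
    and b: "b \<in> {1..d}"
  shows "\<phi> b = b"
proof -
  have perm\<rho>: "permutation \<rho>" using permutes_\<rho> permutation_permutes by blast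
  have "b \<in> (\<Union>r\<in>set R. orbit \<rho> r)" unfolding cover by (rule b)
  then obtain r where r: "r \<in> set R" "b \<in> orbit \<rho> r" by blast
  have sub: "orbit \<rho> r \<subseteq> {1..d}"
    by (rule permutes_orbit_subset[OF permutes_\<rho>]) (rule subsetD[OF roots_subset r(1)])
  have dN: "d \<le> N" by (simp add: num_oedges_def)
  have comm: "\<phi> (\<rho> x) = sigma2 M' (\<phi> x)" if x: "x \<in> orbit \<rho> r" for x
  proof -
    have "x \<in> {1..d}" using sub x by blast
    then have "sigma2 M x = \<rho> x" "x \<in> oedges M" using M dN unfolding labelled_maps_def by auto
    then show ?thesis using iso unfolding map_iso_def by simp
  qed
  have "map \<phi> R = R" using M M' iso unfolding labelled_maps_def map_iso_def by simp
  then have r_eq: "\<phi> r = id r" using r(1) by (metis id_apply list.map_id map_eq_conv)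
  have "id (\<rho> x) = sigma2 M' (id x)" if "x \<in> orbit \<rho> r" for x
    using subsetD[OF sub that] M' unfolding labelled_maps_def by auto
  with comm have "\<phi> b = id b"
    by (rule intertwiners_agree_on_orbit[where p = \<rho> and q = "sigma2 M'" and \<beta> = \<phi> and \<gamma> = id and r = r and x = b,
          OF permutation_self_in_orbit[OF perm\<rho>] r_eq r(2)])
  then show ?thesis by simp
qed

lemma permutes_fixing_boundary_iff:
  "\<phi> permutes {d<..N} \<longleftrightarrow> \<phi> permutes {1..N} \<and> (\<forall>b\<in>{1..d}. \<phi> b = b)"
proof
  assume \<phi>: "\<phi> permutes {d<..N}"
  then have "\<phi> permutes {1..N}" by (rule permutes_subset) auto
  then show "\<phi> permutes {1..N} \<and> (\<forall>b\<in>{1..d}. \<phi> b = b)" using permutes_not_in[OF \<phi>] by auto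
next
  assume \<phi>: "\<phi> permutes {1..N} \<and> (\<forall>b\<in>{1..d}. \<phi> b = b)"
  show "\<phi> permutes {d<..N}"
    by (rule permutes_superset[where S = "{1..N}"]) (use \<phi> in auto)
qed

text \<open>
  Orbit counting: by \<open>iso_fixes_boundary\<close> the equivalences from \<open>M\<close> to labelled maps are the
  permutations of the \<open>N - d\<close> interior labels. Each of these leads to one labelled map, and
  those leading to a given map form a coset of the automorphism group.
\<close>

lemma card_class_times_automorphisms:
  assumes M: "M \<in> labelled_maps"
  shows "card {M' \<in> labelled_maps. (M, M') \<in> map_equiv} * card (automorphisms M) = fact (N - d)"
proof -
  let ?K = "{M' \<in> labelled_maps. (M, M') \<in> map_equiv}"
  define I where "I = (\<lambda>M'. {\<phi>. \<phi> permutes {1..N} \<and> map_iso \<phi> M M'})"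
  have map: "is_map M" and E: "oedges M = {1..N}" using M unfolding labelled_maps_def by auto
  have fin: "finite ?K" using finite_labelled_maps by simp
  have "{\<phi>. \<phi> permutes {d<..N}} = (\<Union>M'\<in>?K. I M')"
  proof (intro equalityI subsetI)
    fix \<phi> assume "\<phi> \<in> {\<phi>. \<phi> permutes {d<..N}}"
    then have \<phi>: "\<phi> permutes {1..N}" and fixb: "\<forall>b\<in>{1..d}. \<phi> b = b"
      using permutes_fixing_boundary_iff by auto
    have inj: "inj_on \<phi> (oedges M)" using permutes_inj_on[OF \<phi>] .
    have iso: "map_iso \<phi> M (relabel \<phi> M)" by (rule map_iso_relabel[OF inj])
    have equiv: "(M, relabel \<phi> M) \<in> map_equiv" by (rule map_equiv_relabel[OF map inj])
    have dN: "d \<le> N" by (simp add: num_oedges_def)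
    have "sigma2 (relabel \<phi> M) b = \<rho> b" if b: "b \<in> {1..d}" for b
    proof -
      have "sigma2 (relabel \<phi> M) (\<phi> b) = \<phi> (sigma2 M b)"
        using iso b dN unfolding map_iso_def E by auto
      moreover have "sigma2 M b = \<rho> b" "\<rho> b \<in> {1..d}"
        using M b permutes_in_image[OF permutes_\<rho>] unfolding labelled_maps_def by auto
      ultimately show ?thesis using fixb b by simp
    qed
    moreover have "map \<phi> R = R" using fixb roots_subset by (intro map_idI) auto
    ultimately have "relabel \<phi> M \<in> labelled_maps"
      using M equiv iso_num_internal[OF map iso] permutes_image[OF \<phi>]
      unfolding labelled_maps_def map_equiv_def by (auto simp: relabel_def)
    then show "\<phi> \<in> (\<Union>M'\<in>?K. I M')" using \<phi> iso equiv unfolding I_def by auto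
  next
    fix \<phi> assume "\<phi> \<in> (\<Union>M'\<in>?K. I M')"
    then obtain M' where "M' \<in> labelled_maps" "\<phi> permutes {1..N}" "map_iso \<phi> M M'"
      unfolding I_def by auto
    then show "\<phi> \<in> {\<phi>. \<phi> permutes {d<..N}}"
      using iso_fixes_boundary[OF M] permutes_fixing_boundary_iff by auto
  qed
  then have "card {\<phi>. \<phi> permutes {d<..N}} = card (\<Union>M'\<in>?K. I M')" by simp
  also have "\<dots> = (\<Sum>M'\<in>?K. card (I M'))"
  proof (rule card_UN_disjoint[OF fin])
    have "I M' \<subseteq> {\<phi>. \<phi> permutes {1..N}}" for M' unfolding I_def by auto
    then show "\<forall>M'\<in>?K. finite (I M')" 
      using finite_subset[OF _ finite_permutations[OF finite_atLeastAtMost]] by blast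
    show "\<forall>M'\<in>?K. \<forall>M''\<in>?K. M' \<noteq> M'' \<longrightarrow> I M' \<inter> I M'' = {}"
      using map_iso_determines unfolding I_def labelled_maps_def by blast
  qed
  also have "\<dots> = (\<Sum>M'\<in>?K. card (automorphisms M))"
  proof (rule sum.cong[OF refl])
    fix M' assume M': "M' \<in> ?K"
    obtain \<psi> where \<psi>: "map_iso \<psi> M M'" using M' unfolding map_equiv_def by auto
    have E': "oedges M' = {1..N}" using M' unfolding labelled_maps_def by simp
    \<comment> \<open>An equivalence is only determined on the oriented edges; \<open>\<chi>\<close> is its extension to a permutation.\<close>
    define \<chi> where "\<chi> = (\<lambda>x. if x \<in> {1..N} then \<psi> x else x)"
    have bij: "bij_betw \<psi> {1..N} {1..N}" using \<psi> unfolding map_iso_def E E' by simp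
    have \<chi>: "\<chi> permutes {1..N}"
    proof (rule bij_imp_permutes)
      show "bij_betw \<chi> {1..N} {1..N}"
        using bij by (rule bij_betw_cong[THEN iffD1, rotated]) (simp add: \<chi>_def)
    qed (simp add: \<chi>_def del: atLeastAtMost_iff)
    have s: "sigma0 M permutes {1..N}" "sigma1 M permutes {1..N}" "sigma2 M permutes {1..N}"
      using map unfolding is_map_def E by blast+
    have in_E: "sigma0 M e \<in> {1..N}" "sigma1 M e \<in> {1..N}" "sigma2 M e \<in> {1..N}"
      if "e \<in> {1..N}" for e
      using that permutes_in_image[OF s(1)] permutes_in_image[OF s(2)] permutes_in_image[OF s(3)]
      by blast+
    have rootsE: "set (roots M) \<subseteq> {1..N}" using map unfolding is_map_def E by simp
    have iso\<chi>: "map_iso \<chi> M M'"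
    proof -
      have "map \<chi> (roots M) = map \<psi> (roots M)" using rootsE by (intro map_cong) (auto simp: \<chi>_def)
      then show ?thesis using \<psi> permutes_imp_bij[OF \<chi>] in_E unfolding map_iso_def E E'
        by (simp add: \<chi>_def del: atLeastAtMost_iff)
    qed
    have "bij_betw (\<lambda>\<alpha>. \<chi> \<circ> \<alpha>) (automorphisms M) (I M')"
    proof (rule bij_betw_byWitness[where f' = "\<lambda>\<phi>. inv \<chi> \<circ> \<phi>"])
      show "\<forall>\<alpha>\<in>automorphisms M. inv \<chi> \<circ> (\<chi> \<circ> \<alpha>) = \<alpha>" "\<forall>\<phi>\<in>I M'. \<chi> \<circ> (inv \<chi> \<circ> \<phi>) = \<phi>"
        by (simp_all add: fun_eq_iff permutes_inverses[OF \<chi>])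
      show "(\<circ>) \<chi> ` automorphisms M \<subseteq> I M'"
      proof
        fix \<phi> assume "\<phi> \<in> (\<circ>) \<chi> ` automorphisms M"
        then obtain \<alpha> where \<alpha>: "\<phi> = \<chi> \<circ> \<alpha>" "\<alpha> permutes {1..N}" "map_iso \<alpha> M M"
          unfolding automorphisms_def E by auto
        have p: "\<phi> permutes {1..N}" unfolding \<alpha>(1) by (rule permutes_compose[OF \<alpha>(2) \<chi>])
        have "map \<chi> (map \<alpha> (roots M)) = roots M'"
          using iso\<chi> \<alpha>(3) unfolding map_iso_def by simp
        then have "roots M' = map \<phi> (roots M)" by (simp add: \<alpha>(1))
        moreover have "s' (\<phi> e) = \<phi> (s e)" if "e \<in> {1..N}" "\<forall>e\<in>{1..N}. s' (\<chi> e) = \<chi> (s e)"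
          "\<forall>e\<in>{1..N}. s (\<alpha> e) = \<alpha> (s e)" for s s' e
          using that permutes_in_image[OF \<alpha>(2)] by (simp add: \<alpha>(1) del: atLeastAtMost_iff)
        ultimately have "map_iso \<phi> M M'"
          using iso\<chi> \<alpha>(3) permutes_imp_bij[OF p] unfolding map_iso_def E E' by blast
        then show "\<phi> \<in> I M'" using p unfolding I_def by simp
      qed
      show "(\<circ>) (inv \<chi>) ` I M' \<subseteq> automorphisms M"
      proof
        fix \<alpha> assume "\<alpha> \<in> (\<circ>) (inv \<chi>) ` I M'"
        then obtain \<phi> where \<phi>: "\<alpha> = inv \<chi> \<circ> \<phi>" "\<phi> permutes {1..N}" "map_iso \<phi> M M'"
          unfolding I_def by auto
        have p: "\<alpha> permutes {1..N}" unfolding \<phi>(1) by (rule permutes_compose[OF \<phi>(2) permutes_inv[OF \<chi>]])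
        have \<chi>\<alpha>: "\<chi> (\<alpha> x) = \<phi> x" for x by (simp add: \<phi>(1) permutes_inverses[OF \<chi>])
        have comm: "s (\<alpha> e) = \<alpha> (s e)" if "e \<in> {1..N}" "\<forall>e\<in>{1..N}. s' (\<chi> e) = \<chi> (s e)"
          "\<forall>e\<in>{1..N}. s' (\<phi> e) = \<phi> (s e)" for s s' e
        proof -
          have "\<chi> (s (\<alpha> e)) = s' (\<chi> (\<alpha> e))" using that permutes_in_image[OF p] by simp
          also have "\<dots> = \<phi> (s e)" using that \<chi>\<alpha> by simp
          also have "\<dots> = \<chi> (\<alpha> (s e))" by (simp add: \<chi>\<alpha>)
          finally show ?thesis using permutes_inj[OF \<chi>] by (simp add: inj_eq)
        qed
        have "map \<chi> (map \<alpha> (roots M)) = map \<chi> (roots M)"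
        proof -
          have "map \<chi> (map \<alpha> (roots M)) = map \<phi> (roots M)" by (simp add: \<chi>\<alpha>)
          also have "\<dots> = map \<chi> (roots M)" using \<phi>(3) iso\<chi> unfolding map_iso_def by simp
          finally show ?thesis .
        qed
        then have "map \<alpha> (roots M) = roots M"
          using permutes_inj[OF \<chi>] by (simp add: inj_map_eq_map del: map_map)
        moreover have "\<forall>e\<in>{1..N}. sigma0 M (\<alpha> e) = \<alpha> (sigma0 M e)"
          "\<forall>e\<in>{1..N}. sigma1 M (\<alpha> e) = \<alpha> (sigma1 M e)"
          "\<forall>e\<in>{1..N}. sigma2 M (\<alpha> e) = \<alpha> (sigma2 M e)"
          using iso\<chi> \<phi>(3) unfolding map_iso_def E by (blast intro: comm)+
        ultimately have "map_iso \<alpha> M M"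
          using permutes_imp_bij[OF p] unfolding map_iso_def E by simp
        then show "\<alpha> \<in> automorphisms M" using p unfolding automorphisms_def E by simp
      qed
    qed
    then show "card (I M') = card (automorphisms M)" by (rule bij_betw_same_card[symmetric])
  qed
  also have "\<dots> = card ?K * card (automorphisms M)" by simp
  finally show ?thesis using card_permutations[OF refl, of "{d<..N}"] by simp
qed

text \<open>
  A class with automorphism group \<open>A\<close> contains \<open>(N - d)! / |A|\<close> labelled maps, all of the same Euler
  characteristic, and every class contains one.
\<close>

lemma sum_class_weight:
  assumes Q: "\<And>M M'. (M, M') \<in> map_equiv \<Longrightarrow> Q M \<longleftrightarrow> Q M'"
  shows "(\<Sum>C\<in>{M \<in> maps_with \<mu> m. Q M} // map_equiv. class_weight C) =
    fls_const (1 / fact (N - d)) * (\<Sum>M\<in>{M \<in> labelled_maps. Q M}. fls_X powi (- euler_char M))"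
proof -
  let ?S = "{M \<in> labelled_maps. Q M}" and ?C = "{M \<in> maps_with \<mu> m. Q M} // map_equiv"
  let ?w = "\<lambda>M :: nat map_data. fls_X powi (- euler_char M) :: rat fls"
  have finS: "finite ?S" using finite_labelled_maps by simp
  have eqv: "equiv {M. is_map M} map_equiv" by (rule equiv_map_equiv)
  have quot: "?C = (\<lambda>M. map_equiv `` {M}) ` ?S"
  proof (intro equalityI subsetI)
    fix C assume "C \<in> ?C"
    then obtain M where M: "M \<in> maps_with \<mu> m" "Q M" "C = map_equiv `` {M}" by (auto elim: quotientE)
    obtain M' where M': "M' \<in> labelled_maps" "(M, M') \<in> map_equiv"
      using labelled_representative_exists[OF M(1)] by blast
    then show "C \<in> (\<lambda>M. map_equiv `` {M}) ` ?S"
      using M Q[OF M'(2)] equiv_class_eq[OF eqv M'(2)] by auto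
  next
    fix C assume "C \<in> (\<lambda>M. map_equiv `` {M}) ` ?S"
    then show "C \<in> ?C" using labelled_maps_subset by (auto intro: quotientI)
  qed
  have fiber: "{M' \<in> ?S. map_equiv `` {M'} = map_equiv `` {M}} = {M' \<in> labelled_maps. (M, M') \<in> map_equiv}"
    if M: "M \<in> ?S" for M
  proof -
    have "map_equiv `` {M'} = map_equiv `` {M} \<longleftrightarrow> (M, M') \<in> map_equiv" if "M' \<in> labelled_maps" for M'
      using that M eq_equiv_class_iff[OF eqv, of M M'] unfolding labelled_maps_def by auto
    then show ?thesis using M Q by auto
  qed
  have "fls_const (1 / fact (N - d)) * (\<Sum>M\<in>?S. ?w M)
      = fls_const (1 / fact (N - d)) * (\<Sum>C\<in>?C. \<Sum>M'\<in>{M' \<in> ?S. map_equiv `` {M'} = C}. ?w M')"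
    unfolding quot by (subst sum.image_gen[OF finS, of _ "\<lambda>M. map_equiv `` {M}"]) (rule refl)
  also have "\<dots> = (\<Sum>C\<in>?C. fls_const (1 / fact (N - d)) * (\<Sum>M'\<in>{M' \<in> ?S. map_equiv `` {M'} = C}. ?w M'))"
    by (rule sum_distrib_left)
  also have "\<dots> = (\<Sum>C\<in>?C. class_weight C)"
  proof (rule sum.cong[OF refl])
    fix C assume "C \<in> ?C"
    then obtain M where M: "M \<in> ?S" "C = map_equiv `` {M}" unfolding quot by auto
    let ?K = "{M' \<in> labelled_maps. (M, M') \<in> map_equiv}"
    have "(\<Sum>M'\<in>{M' \<in> ?S. map_equiv `` {M'} = C}. ?w M') = (\<Sum>M'\<in>?K. ?w M)"
      unfolding M(2) fiber[OF M(1)]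
    proof (rule sum.cong[OF refl])
      fix M' assume "M' \<in> ?K"
      then have "euler_char M' = euler_char M" using iso_euler_char unfolding map_equiv_def by blast
      then show "?w M' = ?w M" by simp
    qed
    also have "\<dots> = of_nat (card ?K) * ?w M" by simp
    finally have "fls_const (1 / fact (N - d)) * (\<Sum>M'\<in>{M' \<in> ?S. map_equiv `` {M'} = C}. ?w M')
        = fls_const (of_nat (card ?K) / fact (N - d)) * ?w M"
      by (simp add: fls_of_nat mult.assoc[symmetric] fls_const_mult_const[symmetric])
    also have "of_nat (card ?K) / fact (N - d) = (1 / of_nat (card (automorphisms M)) :: rat)"
    proof -
      have "of_nat (card ?K) * of_nat (card (automorphisms M)) = (fact (N - d) :: rat)"
        unfolding of_nat_mult[symmetric] using card_class_times_automorphisms[of M] M(1) by simp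
      moreover have "a / f = 1 / b" if "a * b = f" "f \<noteq> 0" for a b f :: rat
        using that by (auto simp: frac_eq_eq)
      ultimately show ?thesis using fact_nonzero by blast
    qed
    also have "fls_const (1 / of_nat (card (automorphisms M))) * ?w M = map_weight M"
      by (simp add: map_weight_def)
    also have "\<dots> = class_weight C"
    proof -
      have "M \<in> C" using M equiv_class_self[OF eqv, of M] by (auto simp: labelled_maps_def)
      then have "(SOME M. M \<in> C) \<in> C" by (rule someI)
      then show ?thesis unfolding class_weight_def using M(2) by (intro map_equiv_weight) auto
    qed
    finally show "fls_const (1 / fact (N - d)) * (\<Sum>M'\<in>{M' \<in> ?S. map_equiv `` {M'} = C}. ?w M') = class_weight C" .
  qed
  finally show ?thesis by simp
qed

end

section \<open>The boundary permutation as a free parameter\<close>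

text \<open>
  What remains of a labelled map when the boundary permutation is forgotten: the edge involution and
  the restriction of the face permutation to the interior labels.
\<close>

definition interior_data :: "nat \<Rightarrow> (nat \<Rightarrow>\<^sub>0 nat) \<Rightarrow> ((nat \<Rightarrow> nat) \<times> (nat \<Rightarrow> nat)) set" where
  "interior_data d m = {(\<alpha>, \<tau>). \<alpha> permutes {1..num_oedges d m} \<and>
    (\<forall>e\<in>{1..num_oedges d m}. \<alpha> e \<noteq> e \<and> \<alpha> (\<alpha> e) = e) \<and> \<tau> permutes {d<..num_oedges d m} \<and>
    (\<forall>k. card {F \<in> cycles_on \<tau> {d<..num_oedges d m}. card F = k} = Poly_Mapping.lookup m k)}"

text \<open>
  The solution \<open>s\<close> of \<open>s \<circ> \<alpha> \<circ> (\<rho> \<circ> \<tau>) = id\<close> for an involution \<open>\<alpha>\<close>.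
\<close>

definition vertex_perm :: "(nat \<Rightarrow> nat) \<Rightarrow> (nat \<Rightarrow> nat) \<times> (nat \<Rightarrow> nat) \<Rightarrow> nat \<Rightarrow> nat" where
  "vertex_perm \<rho> = (\<lambda>(\<alpha>, \<tau>). inv \<tau> \<circ> inv \<rho> \<circ> \<alpha>)"

text \<open>
  The part of \<open>\<hbar>\<close> to the power \<open>-\<chi>\<close> that comes from edges and internal faces.
\<close>

definition interior_weight :: "nat \<Rightarrow> (nat \<Rightarrow>\<^sub>0 nat) \<Rightarrow> (nat \<Rightarrow> nat) \<times> (nat \<Rightarrow> nat) \<Rightarrow> rat fls" where
  "interior_weight d m = (\<lambda>(\<alpha>, \<tau>). fls_X powi
    (int (card (cycles_on \<alpha> {1..num_oedges d m})) - int (card (cycles_on \<tau> {d<..num_oedges d m}))))"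

context rooted_boundary
begin

definition assemble :: "(nat \<Rightarrow> nat) \<times> (nat \<Rightarrow> nat) \<Rightarrow> nat map_data" where
  "assemble = (\<lambda>(\<alpha>, \<tau>). \<lparr>oedges = {1..N}, sigma0 = vertex_perm \<rho> (\<alpha>, \<tau>), sigma1 = \<alpha>,
    sigma2 = \<rho> \<circ> \<tau>, roots = R\<rparr>)"

lemma edge_split: "{1..N} = {1..d} \<union> {d<..N}"
  by (auto simp: num_oedges_def)

lemma permutes_\<rho>_N: "\<rho> permutes {1..N}"
  by (rule permutes_subset[OF permutes_\<rho>]) (auto simp: num_oedges_def)

context
  fixes \<tau> assumes \<tau>: "\<tau> permutes {d<..N}"
begin

lemma permutes_\<tau>_N: "\<tau> permutes {1..N}"
  by (rule permutes_subset[OF \<tau>]) auto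

lemma face_perm_boundary: "b \<in> {1..d} \<Longrightarrow> (\<rho> \<circ> \<tau>) b = \<rho> b"
  using permutes_not_in[OF \<tau>, of b] by simp

lemma face_perm_interior:
  assumes "c \<in> {d<..N}" shows "(\<rho> \<circ> \<tau>) c = \<tau> c"
proof -
  have "\<tau> c \<in> {d<..N}" using assms permutes_in_image[OF \<tau>] by blast
  then show ?thesis using permutes_not_in[OF permutes_\<rho>, of "\<tau> c"] by simp
qed

lemma faces_face_perm:
  "cycles_on (\<rho> \<circ> \<tau>) {1..N} = set (map (orbit \<rho>) R) \<union> cycles_on \<tau> {d<..N}"
proof -
  have "cycles_on (\<rho> \<circ> \<tau>) {1..N} = orbit (\<rho> \<circ> \<tau>) ` {1..d} \<union> orbit (\<rho> \<circ> \<tau>) ` {d<..N}"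
    unfolding cycles_on_def edge_split by (rule image_Un)
  also have "orbit (\<rho> \<circ> \<tau>) ` {1..d} = cycles_on \<rho> {1..d}"
    unfolding cycles_on_def
    by (rule image_cong[OF refl]) (rule orbit_boundary, use face_perm_boundary in auto)
  also have "\<dots> = set (map (orbit \<rho>) R)"
    using sum_\<mu> by (intro cycles_on_rooting[OF permutes_\<rho> _ _ roots_subset rooting]) auto
  also have "orbit (\<rho> \<circ> \<tau>) ` {d<..N} = cycles_on \<tau> {d<..N}"
    unfolding cycles_on_def
  proof (rule image_cong[OF refl])
    fix c assume c: "c \<in> {d<..N}"
    show "orbit (\<rho> \<circ> \<tau>) c = orbit \<tau> c"
    proof (rule sym, rule orbit_cong0[OF c])
      show "\<tau> \<in> {d<..N} \<rightarrow> {d<..N}" using permutes_in_image[OF \<tau>] by blast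
    qed (rule face_perm_interior[symmetric])
  qed
  finally show ?thesis .
qed

lemma boundary_interior_disjoint: "set (map (orbit \<rho>) R) \<inter> cycles_on \<tau> {d<..N} = {}"
proof -
  have bd: "F \<subseteq> {1..d}" if F: "F \<in> set (map (orbit \<rho>) R)" for F
  proof -
    obtain r where r: "r \<in> set R" "F = orbit \<rho> r" using F by auto
    show ?thesis unfolding r(2)
      by (rule permutes_orbit_subset[OF permutes_\<rho>]) (rule subsetD[OF roots_subset r(1)])
  qed
  have int: "F \<subseteq> {d<..N}" "F \<noteq> {}" if "F \<in> cycles_on \<tau> {d<..N}" for F
    using that cycles_on_subset_Pow[OF \<tau>] by (blast, auto simp: cycles_on_def orbit_nonempty)
  show ?thesis
  proof (rule ccontr)
    assume "set (map (orbit \<rho>) R) \<inter> cycles_on \<tau> {d<..N} \<noteq> {}"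
    then obtain F where F: "F \<in> set (map (orbit \<rho>) R)" "F \<in> cycles_on \<tau> {d<..N}" by blast
    obtain x where "x \<in> F" using int(2)[OF F(2)] by blast
    then have "x \<in> {1..d}" "x \<in> {d<..N}" using bd[OF F(1)] int(1)[OF F(2)] by blast+
    then show False by simp
  qed
qed

lemma internal_faces_face_perm:
  assumes "oedges M = {1..N}" "sigma2 M = \<rho> \<circ> \<tau>" "roots M = R"
  shows "internal_faces M = cycles_on \<tau> {d<..N}"
proof -
  have "boundary_faces M = map (orbit \<rho>) R"
    by (rule labelled_boundary_faces) (use assms face_perm_boundary in auto)
  then show ?thesis
    unfolding internal_faces_def faces_def assms(1,2) faces_face_perm
    using boundary_interior_disjoint by auto
qed

end

lemma interior_dataD:
  assumes "(\<alpha>, \<tau>) \<in> interior_data d m"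
  shows "\<alpha> permutes {1..N}" "\<forall>e\<in>{1..N}. \<alpha> e \<noteq> e \<and> \<alpha> (\<alpha> e) = e" "\<tau> permutes {d<..N}"
    "card {F \<in> cycles_on \<tau> {d<..N}. card F = k} = Poly_Mapping.lookup m k"
  using assms unfolding interior_data_def by auto

lemma vertex_perm_permutes:
  assumes "(\<alpha>, \<tau>) \<in> interior_data d m" shows "vertex_perm \<rho> (\<alpha>, \<tau>) permutes {1..N}"
  unfolding vertex_perm_def prod.case
  by (intro permutes_compose permutes_inv interior_dataD[OF assms] permutes_\<rho>_N permutes_\<tau>_N)

lemma assemble_in_labelled_maps:
  assumes "(\<alpha>, \<tau>) \<in> interior_data d m" shows "assemble (\<alpha>, \<tau>) \<in> labelled_maps"
proof -
  note D = interior_dataD[OF assms]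
  let ?M = "assemble (\<alpha>, \<tau>)"
  have sel: "oedges ?M = {1..N}" "sigma0 ?M = vertex_perm \<rho> (\<alpha>, \<tau>)" "sigma1 ?M = \<alpha>"
    "sigma2 ?M = \<rho> \<circ> \<tau>" "roots ?M = R" by (simp_all add: assemble_def)
  have bd: "\<forall>b\<in>{1..d}. (\<rho> \<circ> \<tau>) b = \<rho> b" using face_perm_boundary[OF D(3)] by blast
  have \<alpha>\<alpha>: "\<alpha> (\<alpha> x) = x" for x
  proof (cases "x \<in> {1..N}")
    case True then show ?thesis using D(2) by blast
  next
    case False then show ?thesis using permutes_not_in[OF D(1)] by simp
  qed
  have "vertex_perm \<rho> (\<alpha>, \<tau>) \<circ> \<alpha> \<circ> (\<rho> \<circ> \<tau>) = id"
    by (simp add: fun_eq_iff vertex_perm_def \<alpha>\<alpha> permutes_inverses[OF permutes_\<rho>] permutes_inverses[OF D(3)])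
  moreover have "distinct (map (orbit (\<rho> \<circ> \<tau>)) R)"
  proof -
    have "map (orbit (\<rho> \<circ> \<tau>)) R = map (orbit \<rho>) R"
      using roots_subset by (intro map_cong[OF refl] orbit_boundary[OF bd]) auto
    then show ?thesis using rooting unfolding is_rooting_def by metis
  qed
  moreover have "set R \<subseteq> {1..N}" using roots_subset edge_split by auto
  moreover have "\<rho> \<circ> \<tau> permutes {1..N}" using permutes_\<tau>_N[OF D(3)] permutes_\<rho>_N by (rule permutes_compose)
  ultimately have "is_map ?M"
    using vertex_perm_permutes[OF assms] D(1,2) unfolding is_map_def sel by blast
  moreover have "num_internal ?M k = Poly_Mapping.lookup m k" for k
    unfolding num_internal_def internal_faces_face_perm[OF D(3) sel(1,4,5)] by (rule D(4))
  ultimately show ?thesis unfolding labelled_maps_def using sel bd by simp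
qed

lemma bij_betw_assemble: "bij_betw assemble (interior_data d m) labelled_maps"
proof (rule bij_betw_imageI)
  show "inj_on assemble (interior_data d m)"
  proof (rule inj_onI)
    fix x y assume xy: "x \<in> interior_data d m" "y \<in> interior_data d m" "assemble x = assemble y"
    obtain \<alpha> \<tau> \<alpha>' \<tau>' where eq: "x = (\<alpha>, \<tau>)" "y = (\<alpha>', \<tau>')" by (cases x, cases y) auto
    have "\<alpha> = \<alpha>'" "\<rho> \<circ> \<tau> = \<rho> \<circ> \<tau>'" using xy(3) unfolding eq assemble_def by auto
    then have "\<alpha> = \<alpha>'" "\<tau> = \<tau>'" using permutes_inj[OF permutes_\<rho>] by (auto simp: fun_eq_iff inj_eq)
    then show "x = y" using eq by simp
  qed
  show "assemble ` interior_data d m = labelled_maps"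
  proof (intro equalityI subsetI)
    fix M assume "M \<in> assemble ` interior_data d m"
    then show "M \<in> labelled_maps" using assemble_in_labelled_maps by auto
  next
    fix M assume M: "M \<in> labelled_maps"
    define \<alpha> where "\<alpha> = sigma1 M"
    define \<tau> where "\<tau> = inv \<rho> \<circ> sigma2 M"
    have E: "oedges M = {1..N}" and roots: "roots M = R"
      and bd: "\<forall>b\<in>{1..d}. sigma2 M b = \<rho> b" and int: "\<And>k. num_internal M k = Poly_Mapping.lookup m k"
      using M unfolding labelled_maps_def by auto
    have map: "sigma1 M permutes {1..N}" "sigma2 M permutes {1..N}"
      "\<forall>e\<in>{1..N}. sigma1 M e \<noteq> e \<and> sigma1 M (sigma1 M e) = e" "sigma0 M \<circ> sigma1 M \<circ> sigma2 M = id"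
      using M unfolding labelled_maps_def is_map_def E[symmetric] by blast+
    have s2: "sigma2 M = \<rho> \<circ> \<tau>"
      by (simp add: \<tau>_def fun_eq_iff permutes_inverses[OF permutes_\<rho>])
    have \<tau>: "\<tau> permutes {d<..N}"
      unfolding permutes_fixing_boundary_iff
    proof (intro conjI ballI)
      show "\<tau> permutes {1..N}" unfolding \<tau>_def
        by (rule permutes_compose[OF map(2) permutes_inv[OF permutes_\<rho>_N]])
      show "\<tau> b = b" if "b \<in> {1..d}" for b
        using bd that by (simp add: \<tau>_def permutes_inverses[OF permutes_\<rho>])
    qed
    have "card {F \<in> cycles_on \<tau> {d<..N}. card F = k} = Poly_Mapping.lookup m k" for k
      using int[of k] unfolding num_internal_def internal_faces_face_perm[OF \<tau> E s2 roots] .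
    then have D: "(\<alpha>, \<tau>) \<in> interior_data d m"
      using map(1,3) \<tau> unfolding interior_data_def \<alpha>_def by simp
    have "sigma0 M = vertex_perm \<rho> (\<alpha>, \<tau>)"
    proof
      fix x
      define y where "y = inv \<tau> (inv \<rho> (\<alpha> x))"
      have "\<alpha> (\<alpha> x) = x"
        using map(1,3) permutes_not_in[of \<alpha> "{1..N}" x] by (cases "x \<in> {1..N}") (auto simp: \<alpha>_def)
      then have "sigma1 M (sigma2 M y) = x"
        unfolding y_def s2 \<alpha>_def[symmetric]
        by (simp add: permutes_inverses[OF permutes_\<rho>] permutes_inverses[OF \<tau>])
      then have "sigma0 M x = y" using fun_cong[OF map(4), of y] by simp
      then show "sigma0 M x = vertex_perm \<rho> (\<alpha>, \<tau>) x" by (simp add: y_def vertex_perm_def)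
    qed
    then have "M = assemble (\<alpha>, \<tau>)"
      using E s2 roots by (intro map_data.equality) (simp_all add: assemble_def \<alpha>_def)
    then show "M \<in> assemble ` interior_data d m" using D by (rule image_eqI)
  qed
qed

lemma assemble_weight:
  assumes "x \<in> interior_data d m"
  shows "fls_X powi (- euler_char (assemble x)) =
    interior_weight d m x * isolated_weight {1..N} d d (vertex_perm \<rho> x)"
proof -
  obtain \<alpha> \<tau> where x: "x = (\<alpha>, \<tau>)" by (cases x)
  have \<tau>: "\<tau> permutes {d<..N}" using assms interior_dataD(3) x by blast
  have "internal_faces (assemble x) = cycles_on \<tau> {d<..N}"
    by (rule internal_faces_face_perm[OF \<tau>]) (simp_all add: assemble_def x)
  then have "- euler_char (assemble x) =
      (int (card (cycles_on \<alpha> {1..N})) - int (card (cycles_on \<tau> {d<..N})))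
      + - int (card (cycles_on (vertex_perm \<rho> x) {1..N}))"
    unfolding euler_char_def vertices_def edges_def by (simp add: assemble_def x)
  moreover have "isolated (vertex_perm \<rho> x) d d" by (simp add: isolated_def)
  ultimately show ?thesis
    unfolding isolated_weight_def interior_weight_def x prod.case
    by (simp only: if_True) (rule power_int_add, simp)
qed

lemma fully_simple_assemble:
  assumes "x \<in> interior_data d m"
  shows "fully_simple (assemble x) \<longleftrightarrow> isolated (vertex_perm \<rho> x) d 0"
proof -
  obtain \<alpha> \<tau> where x: "x = (\<alpha>, \<tau>)" by (cases x)
  have \<tau>: "\<tau> permutes {d<..N}" using assms interior_dataD(3) x by blast
  define s where "s = vertex_perm \<rho> x"
  have s: "permutation s"
    using vertex_perm_permutes assms permutation_permutes unfolding s_def x by blast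
  have bd: "boundary_edges (assemble x) = {1..d}"
    by (rule labelled_boundary_edges) (use face_perm_boundary[OF \<tau>] in \<open>auto simp: assemble_def x\<close>)
  have fin: "finite (orbit s e \<inter> {1..d})" for e by simp
  have "fully_simple (assemble x) \<longleftrightarrow> (\<forall>e\<in>{1..N}. card (orbit s e \<inter> {1..d}) \<le> 1)"
    unfolding fully_simple_def vertices_def cycles_on_def bd by (simp add: assemble_def x s_def)
  also have "\<dots> \<longleftrightarrow> (\<forall>b\<in>{1..d}. orbit s b \<inter> {1..d} \<subseteq> {b})"
  proof (intro iffI ballI)
    fix b assume le: "\<forall>e\<in>{1..N}. card (orbit s e \<inter> {1..d}) \<le> 1" and b: "b \<in> {1..d}"
    then have "card (orbit s b \<inter> {1..d}) \<le> Suc 0" using edge_split by auto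
    then have "\<forall>x\<in>orbit s b \<inter> {1..d}. \<forall>y\<in>orbit s b \<inter> {1..d}. x = y"
      unfolding card_le_Suc0_iff_eq[OF fin] .
    moreover have "b \<in> orbit s b \<inter> {1..d}" using b permutation_self_in_orbit[OF s] by blast
    ultimately show "orbit s b \<inter> {1..d} \<subseteq> {b}" by blast
  next
    fix e assume sub: "\<forall>b\<in>{1..d}. orbit s b \<inter> {1..d} \<subseteq> {b}" and "e \<in> {1..N}"
    have "b = c" if "b \<in> orbit s e \<inter> {1..d}" "c \<in> orbit s e \<inter> {1..d}" for b c
      using sub that orbit_eq_of_mem[OF s, of b e] by blast
    then have "card (orbit s e \<inter> {1..d}) \<le> Suc 0"
      unfolding card_le_Suc0_iff_eq[OF fin] by blast
    then show "card (orbit s e \<inter> {1..d}) \<le> 1" by simp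
  qed
  also have "\<dots> \<longleftrightarrow> isolated s d 0"
  proof -
    have "{0<..d} = {1..d}" by auto
    then show ?thesis unfolding isolated_def by simp
  qed
  finally show ?thesis unfolding s_def .
qed

lemma Map_gf_eq_interior_sum:
  "Map_gf \<mu> m = fls_const (1 / fact (N - d)) *
    (\<Sum>x\<in>interior_data d m. interior_weight d m x * isolated_weight {1..N} d d (vertex_perm \<rho> x))"
proof -
  have "Map_gf \<mu> m = fls_const (1 / fact (N - d)) * (\<Sum>M\<in>labelled_maps. fls_X powi (- euler_char M))"
    unfolding Map_gf_def using sum_class_weight[of "\<lambda>_. True"] by simp
  also have "(\<Sum>M\<in>labelled_maps. fls_X powi (- euler_char M))
      = (\<Sum>x\<in>interior_data d m. fls_X powi (- euler_char (assemble x)) :: rat fls)"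
    by (rule sum.reindex_bij_betw[OF bij_betw_assemble, symmetric])
  also have "\<dots> = (\<Sum>x\<in>interior_data d m. interior_weight d m x * isolated_weight {1..N} d d (vertex_perm \<rho> x))"
    by (rule sum.cong[OF refl]) (rule assemble_weight)
  finally show ?thesis .
qed

lemma FSMap_gf_eq_interior_sum:
  "FSMap_gf \<mu> m = fls_const (1 / fact (N - d)) *
    (\<Sum>x\<in>interior_data d m. interior_weight d m x * isolated_weight {1..N} d 0 (vertex_perm \<rho> x))"
proof -
  have "FSMap_gf \<mu> m = fls_const (1 / fact (N - d)) *
      (\<Sum>M\<in>{M \<in> labelled_maps. fully_simple M}. fls_X powi (- euler_char M))"
    unfolding FSMap_gf_def
    by (rule sum_class_weight) (use iso_fully_simple in \<open>auto simp: map_equiv_def\<close>)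
  also have "(\<Sum>M\<in>{M \<in> labelled_maps. fully_simple M}. fls_X powi (- euler_char M) :: rat fls)
      = (\<Sum>M\<in>labelled_maps. if fully_simple M then fls_X powi (- euler_char M) else 0)"
    by (rule sum.inter_filter[OF finite_labelled_maps])
  also have "\<dots> = (\<Sum>x\<in>interior_data d m. if fully_simple (assemble x)
      then fls_X powi (- euler_char (assemble x)) else 0)"
    by (rule sum.reindex_bij_betw[OF bij_betw_assemble, symmetric])
  also have "\<dots> = (\<Sum>x\<in>interior_data d m. interior_weight d m x * isolated_weight {1..N} d 0 (vertex_perm \<rho> x))"
  proof (rule sum.cong[OF refl])
    fix x assume x: "x \<in> interior_data d m"
    have "isolated (vertex_perm \<rho> x) d d" by (simp add: isolated_def)
    then show "(if fully_simple (assemble x) then fls_X powi (- euler_char (assemble x)) else 0)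
      = interior_weight d m x * isolated_weight {1..N} d 0 (vertex_perm \<rho> x)"
      unfolding assemble_weight[OF x] fully_simple_assemble[OF x] isolated_weight_def by simp
  qed
  finally show ?thesis .
qed

text \<open>
  The inverse of \<open>\<pi>\<close> appears next to that of \<open>\<rho>\<close> and can be moved past \<open>\<tau>\<close>, which permutes other labels.
\<close>

lemma vertex_perm_comp:
  assumes \<pi>: "\<pi> permutes {1..d}" and x: "x \<in> interior_data d m"
  shows "vertex_perm (\<rho> \<circ> \<pi>) x = inv \<pi> \<circ> vertex_perm \<rho> x"
proof -
  obtain \<alpha> \<tau> where eq: "x = (\<alpha>, \<tau>)" by (cases x)
  have \<tau>: "\<tau> permutes {d<..N}" using x interior_dataD(3) eq by blast
  have \<pi>i: "inv \<pi> permutes {1..d}" and \<tau>i: "inv \<tau> permutes {d<..N}"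
    using \<pi> \<tau> permutes_inv by blast+
  have "inv \<tau> (inv \<pi> y) = inv \<pi> (inv \<tau> y)" for y
  proof (cases "y \<in> {1..d}")
    case True
    moreover have "inv \<pi> y \<in> {1..d}" using True permutes_in_image[OF \<pi>i] by blast
    ultimately show ?thesis
      using permutes_not_in[OF \<tau>i, of y] permutes_not_in[OF \<tau>i, of "inv \<pi> y"] by simp
  next
    case False
    have "inv \<tau> y \<notin> {1..d}"
    proof (cases "y \<in> {d<..N}")
      case True
      then have "inv \<tau> y \<in> {d<..N}" using permutes_in_image[OF \<tau>i] by blast
      then show ?thesis by simp
    next
      case outside: False
      show ?thesis using False permutes_not_in[OF \<tau>i outside] by simp
    qed
    then show ?thesis
      using False permutes_not_in[OF \<pi>i, of y] permutes_not_in[OF \<pi>i, of "inv \<tau> y"] by simp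
  qed
  moreover have "inv (\<rho> \<circ> \<pi>) = inv \<pi> \<circ> inv \<rho>"
    using permutes_bij[OF permutes_\<rho>] permutes_bij[OF \<pi>] by (rule o_inv_distrib)
  ultimately show ?thesis by (simp add: eq vertex_perm_def fun_eq_iff)
qed

text \<open>
  The same interior data serve all boundary permutations \<open>\<rho> \<circ> \<pi>\<close>, so
  \<open>sum_monotone_gf_isolated_weight\<close> can be applied to the vertex permutation of each of them separately.
\<close>

lemma FSMap_gf_eq_sum_Map_gf:
  assumes rooted: "\<And>\<pi>. \<pi> permutes {1..d} \<Longrightarrow> \<exists>R. rooted_boundary d (\<nu> \<pi>) (\<rho> \<circ> \<pi>) R"
  shows "FSMap_gf \<mu> m =
    (\<Sum>\<pi>\<in>{\<pi>. \<pi> permutes {1..d}}. fps_to_fls (monotone_gf d \<pi>) * Map_gf (\<nu> \<pi>) m)"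
proof -
  let ?S = "{\<pi>. \<pi> permutes {1..d}}" and ?D = "interior_data d m"
  let ?g = "\<lambda>\<pi>. fps_to_fls (monotone_gf d \<pi>)" and ?u = "interior_weight d m"
  let ?F = "\<lambda>j. isolated_weight {1..N} d j" and ?c = "fls_const (1 / fact (N - d)) :: rat fls"
  have "?F 0 (vertex_perm \<rho> x) = (\<Sum>\<pi>\<in>?S. ?g \<pi> * ?F d (vertex_perm (\<rho> \<circ> \<pi>) x))" if x: "x \<in> ?D" for x
  proof -
    have "vertex_perm \<rho> x permutes {1..N}" using vertex_perm_permutes x by (cases x) blast
    moreover have "{1..d} \<subseteq> {1..N}" using edge_split by blast
    ultimately have "?F 0 (vertex_perm \<rho> x) = (\<Sum>\<pi>\<in>?S. ?g \<pi> * ?F d (inv \<pi> \<circ> vertex_perm \<rho> x))"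
      by (intro sum_monotone_gf_isolated_weight[symmetric]) auto
    also have "\<dots> = (\<Sum>\<pi>\<in>?S. ?g \<pi> * ?F d (vertex_perm (\<rho> \<circ> \<pi>) x))"
      using vertex_perm_comp[OF _ x] by (intro sum.cong) auto
    finally show ?thesis .
  qed
  then have "FSMap_gf \<mu> m = ?c * (\<Sum>x\<in>?D. \<Sum>\<pi>\<in>?S. ?g \<pi> * (?u x * ?F d (vertex_perm (\<rho> \<circ> \<pi>) x)))"
    unfolding FSMap_gf_eq_interior_sum by (simp add: sum_distrib_left mult.left_commute)
  also have "\<dots> = (\<Sum>\<pi>\<in>?S. ?g \<pi> * (?c * (\<Sum>x\<in>?D. ?u x * ?F d (vertex_perm (\<rho> \<circ> \<pi>) x))))"
    by (subst sum.swap) (simp add: sum_distrib_left mult.left_commute)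
  also have "\<dots> = (\<Sum>\<pi>\<in>?S. ?g \<pi> * Map_gf (\<nu> \<pi>) m)"
  proof (rule sum.cong[OF refl])
    fix \<pi> assume "\<pi> \<in> ?S"
    then obtain R' where "rooted_boundary d (\<nu> \<pi>) (\<rho> \<circ> \<pi>) R'" using rooted by blast
    then show "?g \<pi> * (?c * (\<Sum>x\<in>?D. ?u x * ?F d (vertex_perm (\<rho> \<circ> \<pi>) x))) = ?g \<pi> * Map_gf (\<nu> \<pi>) m"
      using rooted_boundary.Map_gf_eq_interior_sum by simp
  qed
  finally show ?thesis .
qed

end

section \<open>Averaging over permutations of a given cycle type\<close>

definition cycle_partition :: "nat \<Rightarrow> (nat \<Rightarrow> nat) \<Rightarrow> nat list" where
  "cycle_partition d p = rev (sorted_list_of_multiset (cycle_type_on p {1..d}))"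

lemma mset_cycle_partition: "mset (cycle_partition d p) = cycle_type_on p {1..d}"
  by (simp add: cycle_partition_def)

lemma cycle_partition_in_partitions:
  assumes p: "p permutes {1..d}" shows "cycle_partition d p \<in> partitions d"
proof -
  let ?\<nu> = "cycle_partition d p"
  have perm: "permutation p" using p permutation_permutes by blast
  have "sorted (rev ?\<nu>)" by (simp add: cycle_partition_def sorted_sorted_list_of_multiset)
  then have "sorted_wrt (\<ge>) ?\<nu>" unfolding sorted_wrt_rev .
  moreover have "x > 0" if "x \<in> set ?\<nu>" for x
  proof -
    have "x \<in># cycle_type_on p {1..d}" using that mset_cycle_partition[of d p] by (metis set_mset_mset)
    then obtain b where "x = card (orbit p b)" unfolding cycle_type_on_def cycles_on_def by auto
    then show ?thesis using finite_orbit_permutation[OF perm] orbit_nonempty by (simp add: card_gt_0_iff)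
  qed
  moreover have "sum_list ?\<nu> = d"
  proof -
    have "sum_list ?\<nu> = sum_mset (cycle_type_on p {1..d})"
      unfolding mset_cycle_partition[symmetric] by (simp add: sum_mset_sum_list)
    also have "\<dots> = (\<Sum>C\<in>cycles_on p {1..d}. card C)"
      unfolding cycle_type_on_def by (simp add: sum_unfold_sum_mset)
    also have "\<dots> = d" using sum_card_cycles[OF p] by simp
    finally show ?thesis .
  qed
  ultimately show ?thesis unfolding partitions_def by blast
qed

lemma partition_eq_cycle_partition_iff:
  assumes "\<nu> \<in> partitions d"
  shows "cycle_type_on p {1..d} = mset \<nu> \<longleftrightarrow> \<nu> = cycle_partition d p"
proof
  assume "cycle_type_on p {1..d} = mset \<nu>"
  then have "cycle_partition d p = rev (sort \<nu>)" by (simp add: cycle_partition_def)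
  moreover have "sorted (rev \<nu>)" using assms unfolding partitions_def sorted_wrt_rev by blast
  then have "sort \<nu> = rev \<nu>" by (intro properties_for_sort) auto
  ultimately show "\<nu> = cycle_partition d p" by simp
qed (simp add: mset_cycle_partition)

lemma z_partition_pos: "\<forall>x\<in>set \<nu>. x > 0 \<Longrightarrow> z_partition \<nu> > 0"
  by (auto simp: z_partition_def prod_list_zero_iff intro!: Nat.gr0I)

lemma rooted_boundary_exists:
  assumes \<rho>: "\<rho> permutes {1..d}" and \<mu>: "\<mu> \<in> partitions d" and type: "cycle_type_on \<rho> {1..d} = mset \<mu>"
  shows "\<exists>R. rooted_boundary d \<mu> \<rho> R"
proof -
  have "card {R. set R \<subseteq> {1..d} \<and> is_rooting \<rho> \<mu> R} = z_partition \<mu>"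
    by (rule card_rootings[OF \<rho> _ type]) simp
  moreover have "z_partition \<mu> > 0" using \<mu> z_partition_pos unfolding partitions_def by blast
  ultimately have "{R. set R \<subseteq> {1..d} \<and> is_rooting \<rho> \<mu> R} \<noteq> {}" by (metis card.empty less_irrefl)
  then obtain R where "set R \<subseteq> {1..d}" "is_rooting \<rho> \<mu> R" by blast
  then have "rooted_boundary d \<mu> \<rho> R"
    using \<rho> \<mu> unfolding rooted_boundary_def partitions_def by blast
  then show ?thesis ..
qed

lemma finite_partitions: "finite (partitions d)"
proof (rule finite_subset)
  show "partitions d \<subseteq> {xs. set xs \<subseteq> {..d} \<and> length xs \<le> d}"
  proof
    fix xs assume "xs \<in> partitions d"
    then have xs: "\<forall>x\<in>set xs. x > 0" "sum_list xs = d" unfolding partitions_def by auto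
    have "length ys \<le> sum_list ys" if "\<forall>x\<in>set ys. x > 0" for ys :: "nat list"
      using that by (induction ys) auto
    then show "xs \<in> {xs. set xs \<subseteq> {..d} \<and> length xs \<le> d}"
      using xs member_le_sum_list by fastforce
  qed
qed (rule finite_lists_length_le, simp)

lemma cycle_type_on_inv:
  assumes "permutation p" shows "cycle_type_on (inv p) S = cycle_type_on p S"
  unfolding cycle_type_on_def cycles_on_def using orbit_inv_eq[OF assms] by simp

text \<open>
  The last permutation of a Hurwitz tuple is the inverse of the product of the others, and inversion
  preserves the cycle type.
\<close>

lemma card_hurwitz_tuples:
  "card (hurwitz_tuples d k \<mu> \<nu>) =
    (\<Sum>\<rho>\<in>{\<rho>. \<rho> permutes {1..d} \<and> cycle_type_on \<rho> {1..d} = mset \<mu>}.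
      \<Sum>\<pi>\<in>{\<pi>. \<pi> permutes {1..d} \<and> cycle_type_on (\<rho> \<circ> \<pi>) {1..d} = mset \<nu>}.
        card (monotone_factorizations d k \<pi>))"
proof -
  let ?K = "{\<rho>. \<rho> permutes {1..d} \<and> cycle_type_on \<rho> {1..d} = mset \<mu>}"
  let ?L = "\<lambda>\<rho>. {\<pi>. \<pi> permutes {1..d} \<and> cycle_type_on (\<rho> \<circ> \<pi>) {1..d} = mset \<nu>}"
  let ?T = "SIGMA \<rho>:?K. SIGMA \<pi>:?L \<rho>. monotone_factorizations d k \<pi>"
  let ?h = "\<lambda>(\<rho>, \<pi>, \<tau>s). (\<rho>, \<tau>s, inv (\<rho> \<circ> \<pi>))"
  have "hurwitz_tuples d k \<mu> \<nu> = ?h ` ?T"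
  proof (intro equalityI subsetI)
    fix t assume "t \<in> hurwitz_tuples d k \<mu> \<nu>"
    then obtain \<rho> \<tau>s \<rho>' where t: "t = (\<rho>, \<tau>s, \<rho>')" and \<rho>: "\<rho> \<in> ?K"
      and \<rho>': "\<rho>' permutes {1..d}" "cycle_type_on \<rho>' {1..d} = mset \<nu>"
      and \<tau>s: "length \<tau>s = k" "weakly_monotone d \<tau>s" and prod: "\<rho> \<circ> foldr (\<circ>) \<tau>s id \<circ> \<rho>' = id"
      unfolding hurwitz_tuples_def by blast
    define \<pi> where "\<pi> = foldr (\<circ>) \<tau>s id"
    have \<pi>: "\<pi> permutes {1..d}" unfolding \<pi>_def by (rule permutes_foldr_comp[OF \<tau>s(2)])
    have p: "\<rho> \<circ> \<pi> permutes {1..d}" using \<rho> \<pi> by (intro permutes_compose) auto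
    then have perm: "permutation (\<rho> \<circ> \<pi>)" by (rule permutes_imp_permutation[rotated]) simp
    have "\<rho>' = inv (\<rho> \<circ> \<pi>)"
    proof
      fix x
      have "(\<rho> \<circ> \<pi>) (\<rho>' x) = x" using fun_cong[OF prod, of x] by (simp add: \<pi>_def)
      then show "\<rho>' x = inv (\<rho> \<circ> \<pi>) x" using permutes_inv_eq[OF p, of x] by metis
    qed
    moreover from this have "cycle_type_on (\<rho> \<circ> \<pi>) {1..d} = mset \<nu>"
      using \<rho>'(2) cycle_type_on_inv[OF perm] by simp
    ultimately have "t = ?h (\<rho>, \<pi>, \<tau>s)" "(\<rho>, \<pi>, \<tau>s) \<in> ?T"
      using t \<rho> \<pi> \<tau>s unfolding monotone_factorizations_def by (auto simp: \<pi>_def)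
    then show "t \<in> ?h ` ?T" by (rule image_eqI)
  next
    fix t assume "t \<in> ?h ` ?T"
    then obtain \<rho> \<pi> \<tau>s where t: "t = (\<rho>, \<tau>s, inv (\<rho> \<circ> \<pi>))" and \<rho>: "\<rho> \<in> ?K" and \<pi>: "\<pi> \<in> ?L \<rho>"
      and \<tau>s: "\<tau>s \<in> monotone_factorizations d k \<pi>" by auto
    have p: "\<rho> \<circ> \<pi> permutes {1..d}" using \<rho> \<pi> by (intro permutes_compose) auto
    then have perm: "permutation (\<rho> \<circ> \<pi>)" by (rule permutes_imp_permutation[rotated]) simp
    have "cycle_type_on (inv (\<rho> \<circ> \<pi>)) {1..d} = mset \<nu>"
      using \<pi> unfolding cycle_type_on_inv[OF perm] by simp
    moreover have "\<rho> \<circ> foldr (\<circ>) \<tau>s id \<circ> inv (\<rho> \<circ> \<pi>) = id"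
    proof -
      have "foldr (\<circ>) \<tau>s id = \<pi>" using \<tau>s unfolding monotone_factorizations_def by simp
      then show ?thesis using permutes_inv_o(1)[OF p] by simp
    qed
    ultimately show "t \<in> hurwitz_tuples d k \<mu> \<nu>"
      using t \<rho> \<tau>s permutes_inv[OF p] unfolding hurwitz_tuples_def monotone_factorizations_def
      by simp
  qed
  moreover have "inj_on ?h ?T"
  proof (rule inj_onI)
    fix x y assume xy: "x \<in> ?T" "y \<in> ?T" "?h x = ?h y"
    obtain \<rho> \<pi> \<tau>s \<rho>' \<pi>' \<tau>s' where eq: "x = (\<rho>, \<pi>, \<tau>s)" "y = (\<rho>', \<pi>', \<tau>s')" by (metis prod.exhaust)
    have "\<pi> = foldr (\<circ>) \<tau>s id" "\<pi>' = foldr (\<circ>) \<tau>s' id"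
      using xy(1,2) unfolding eq monotone_factorizations_def by simp_all
    moreover have "\<rho> = \<rho>'" "\<tau>s = \<tau>s'" using xy(3) unfolding eq by simp_all
    ultimately show "x = y" unfolding eq by simp
  qed
  ultimately have "card (hurwitz_tuples d k \<mu> \<nu>) = card ?T" by (simp only: card_image)
  also have "\<dots> = (\<Sum>\<rho>\<in>?K. card (SIGMA \<pi>:?L \<rho>. monotone_factorizations d k \<pi>))"
    by (intro card_SigmaI ballI finite_SigmaI finite_monotone_factorizations)
      (auto simp: finite_permutations)
  also have "\<dots> = (\<Sum>\<rho>\<in>?K. \<Sum>\<pi>\<in>?L \<rho>. card (monotone_factorizations d k \<pi>))"
    by (intro sum.cong refl card_SigmaI ballI finite_monotone_factorizations)
      (auto simp: finite_permutations)
  finally show ?thesis .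
qed

lemma monotone_hurwitz_gf_neg:
  "fps_const (fact d) * (monotone_hurwitz_gf d \<mu> \<nu> oo - fps_X) =
    (\<Sum>\<rho>\<in>{\<rho>. \<rho> permutes {1..d} \<and> cycle_type_on \<rho> {1..d} = mset \<mu>}.
      \<Sum>\<pi>\<in>{\<pi>. \<pi> permutes {1..d} \<and> cycle_type_on (\<rho> \<circ> \<pi>) {1..d} = mset \<nu>}. monotone_gf d \<pi>)"
proof (rule fps_ext)
  fix k
  have "(fps_const (fact d) * (monotone_hurwitz_gf d \<mu> \<nu> oo - fps_X)) $ k
      = (-1) ^ k * of_nat (card (hurwitz_tuples d k \<mu> \<nu>))"
    by (simp add: fps_compose_uminus' monotone_hurwitz_gf_def monotone_hurwitz_num_def)
  then show "(fps_const (fact d) * (monotone_hurwitz_gf d \<mu> \<nu> oo - fps_X)) $ k =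
    (\<Sum>\<rho>\<in>{\<rho>. \<rho> permutes {1..d} \<and> cycle_type_on \<rho> {1..d} = mset \<mu>}.
      \<Sum>\<pi>\<in>{\<pi>. \<pi> permutes {1..d} \<and> cycle_type_on (\<rho> \<circ> \<pi>) {1..d} = mset \<nu>}. monotone_gf d \<pi>) $ k"
    by (simp add: card_hurwitz_tuples monotone_gf_def fps_sum_nth sum_distrib_left)
qed

theorem corollary1p6:
  fixes d :: nat and \<mu> :: "nat list"
  assumes "d > 0" and "\<mu> \<in> partitions d"
  shows "FSMap_gf \<mu> =
    (\<lambda>m. of_nat (z_partition \<mu>) *
      (\<Sum>\<nu>\<in>partitions d.
        fps_to_fls (fps_compose (monotone_hurwitz_gf d \<mu> \<nu>) (- fps_X)) * Map_gf \<nu> m))"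
proof
  fix m
  let ?K = "{\<rho>. \<rho> permutes {1..d} \<and> cycle_type_on \<rho> {1..d} = mset \<mu>}"
  let ?S = "{\<pi>. \<pi> permutes {1..d}}"
  let ?L = "\<lambda>\<rho> \<nu>. {\<pi>. \<pi> permutes {1..d} \<and> cycle_type_on (\<rho> \<circ> \<pi>) {1..d} = mset \<nu>}"
  let ?g = "\<lambda>\<pi>. fps_to_fls (monotone_gf d \<pi>)"
  let ?H = "\<lambda>\<nu>. fps_to_fls (fps_compose (monotone_hurwitz_gf d \<mu> \<nu>) (- fps_X))"
  have expand: "(\<Sum>\<nu>\<in>partitions d. \<Sum>\<pi>\<in>?L \<rho> \<nu>. ?g \<pi> * Map_gf \<nu> m) = FSMap_gf \<mu> m" if \<rho>: "\<rho> \<in> ?K" for \<rho>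
  proof -
    have comp: "\<rho> \<circ> \<pi> permutes {1..d}" if "\<pi> permutes {1..d}" for \<pi>
      using \<rho> that by (intro permutes_compose) auto
    have "(\<Sum>\<nu>\<in>partitions d. \<Sum>\<pi>\<in>?L \<rho> \<nu>. ?g \<pi> * Map_gf \<nu> m)
        = (\<Sum>\<nu>\<in>partitions d. \<Sum>\<pi>\<in>?S. if \<nu> = cycle_partition d (\<rho> \<circ> \<pi>) then ?g \<pi> * Map_gf \<nu> m else 0)"
    proof (rule sum.cong[OF refl])
      fix \<nu> assume \<nu>: "\<nu> \<in> partitions d"
      have "?L \<rho> \<nu> = {\<pi> \<in> ?S. \<nu> = cycle_partition d (\<rho> \<circ> \<pi>)}"
        unfolding partition_eq_cycle_partition_iff[OF \<nu>] by simp
      then show "(\<Sum>\<pi>\<in>?L \<rho> \<nu>. ?g \<pi> * Map_gf \<nu> m)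
        = (\<Sum>\<pi>\<in>?S. if \<nu> = cycle_partition d (\<rho> \<circ> \<pi>) then ?g \<pi> * Map_gf \<nu> m else 0)"
        by (simp only: sum.inter_filter[OF finite_permutations[OF finite_atLeastAtMost]])
    qed
    also have "\<dots> = (\<Sum>\<pi>\<in>?S. ?g \<pi> * Map_gf (cycle_partition d (\<rho> \<circ> \<pi>)) m)"
      using cycle_partition_in_partitions[OF comp] finite_partitions
      by (subst sum.swap) (auto intro!: sum.cong)
    also have "\<dots> = FSMap_gf \<mu> m"
    proof -
      obtain R where "rooted_boundary d \<mu> \<rho> R" using rooted_boundary_exists assms(2) \<rho> by blast
      moreover have "\<exists>R. rooted_boundary d (cycle_partition d (\<rho> \<circ> \<pi>)) (\<rho> \<circ> \<pi>) R"
        if "\<pi> permutes {1..d}" for \<pi>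
        by (rule rooted_boundary_exists[OF comp[OF that]
              cycle_partition_in_partitions[OF comp[OF that]] mset_cycle_partition[symmetric]])
      ultimately show ?thesis by (rule rooted_boundary.FSMap_gf_eq_sum_Map_gf[symmetric])
    qed
    finally show ?thesis .
  qed
  have H: "of_nat (fact d) * ?H \<nu> = (\<Sum>\<rho>\<in>?K. \<Sum>\<pi>\<in>?L \<rho> \<nu>. ?g \<pi>)" for \<nu>
  proof -
    have "fps_const (fact d :: rat) = of_nat (fact d)" 
      by (simp only: fps_of_nat[symmetric] of_nat_fact)
    then have "fps_to_fls (fps_const (fact d)) = (of_nat (fact d) :: rat fls)"
      by (simp only: fps_to_fls_of_nat)
    then show ?thesis
      using arg_cong[OF monotone_hurwitz_gf_neg[of d \<mu> \<nu>], of fps_to_fls]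
      by (simp only: fls_times_fps_to_fls fps_to_fls_sum)
  qed
  have class_size: "card ?K * z_partition \<mu> = fact d"
    using card_permutations_of_cycle_type[of "{1..d}" \<mu>] assms(2) unfolding partitions_def by simp
  have "of_nat (fact d) * (\<Sum>\<nu>\<in>partitions d. ?H \<nu> * Map_gf \<nu> m)
      = (\<Sum>\<nu>\<in>partitions d. (\<Sum>\<rho>\<in>?K. \<Sum>\<pi>\<in>?L \<rho> \<nu>. ?g \<pi>) * Map_gf \<nu> m)"
    by (simp only: sum_distrib_left mult.assoc[symmetric] H)
  also have "\<dots> = (\<Sum>\<rho>\<in>?K. \<Sum>\<nu>\<in>partitions d. \<Sum>\<pi>\<in>?L \<rho> \<nu>. ?g \<pi> * Map_gf \<nu> m)"
    by (simp only: sum_distrib_right) (rule sum.swap)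
  also have "\<dots> = of_nat (card ?K) * FSMap_gf \<mu> m" using expand by simp
  finally have "of_nat (fact d) * (of_nat (z_partition \<mu>) * (\<Sum>\<nu>\<in>partitions d. ?H \<nu> * Map_gf \<nu> m))
      = of_nat (card ?K * z_partition \<mu>) * FSMap_gf \<mu> m"
    by (simp add: mult.left_commute mult.commute)
  then have "of_nat (fact d) * FSMap_gf \<mu> m
      = of_nat (fact d) * (of_nat (z_partition \<mu>) * (\<Sum>\<nu>\<in>partitions d. ?H \<nu> * Map_gf \<nu> m))"
    unfolding class_size by (rule sym)
  moreover have "(of_nat (fact d) :: rat fls) \<noteq> 0" unfolding of_nat_eq_0_iff by simp
  ultimately show "FSMap_gf \<mu> m =
      of_nat (z_partition \<mu>) * (\<Sum>\<nu>\<in>partitions d. ?H \<nu> * Map_gf \<nu> m)"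
    by (simp only: mult_cancel_left if_False simp_thms)
qed

end
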